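(* Let $N$ be a positive integer. For $h=(h_x,h_z,h_{zz})$ and $\gamma=\big((\gamma_j^k)_{1\le j\le N,\,k\in\{x,z\}},(\gamma_j^{zz})_{1\le j\le N-1}\big)\in[-1,1]^{\times(3N-1)}$ define the Hamiltonian on $(\mathbb C^2)^{\otimes N}$ $$H^{XXZ}_h(\gamma)=\sum_{j=1}^N\big(h_x\gamma_j^x\hat\sigma_j^x+h_z\gamma_j^z\hat\sigma_j^z\big)+\sum_{j=1}^{N-1}\big(\hat\sigma_j^x\hat\sigma_{j+1}^x+\hat\sigma_j^y\hat\sigma_{j+1}^y+h_{zz}\gamma_j^{zz}\hat\sigma_j^z\hat\sigma_{j+1}^z\big).$$ Then for any $h\in(0,+\infty)^{\times 3}$, the set of all $\gamma\in[-1,1]^{\times(3N-1)}$ such that the spectrum of $H^{XXZ}_h(\gamma)$ has degenerate gaps (i.e. does not have non-degenerate gaps) is of Lebesgue measure zero.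
   Context: $\hat\sigma_j^x,\hat\sigma_j^y,\hat\sigma_j^z$ are the Pauli matrices $\begin{pmatrix}0&1\\1&0\end{pmatrix},\begin{pmatrix}0&-i\\i&0\end{pmatrix},\begin{pmatrix}1&0\\0&-1\end{pmatrix}$ acting on the $j$-th tensor factor (spin-$1/2$ at position $j$) of $(\mathbb C^2)^{\otimes N}$, and as identity on the others. Non-degenerate gaps: the spectrum $\{E_j\}_{j=1}^{2^N}$ of a Hamiltonian (eigenvalues listed with multiplicity) has non-degenerate gaps if the differences $\{E_j-E_k\}_{j\ne k}$ are all distinct, i.e. for any $j\neq k$, $E_j-E_k=E_{j'}-E_{k'}$ implies $j=j'$ and $k=k'$. *)

theory Defs
  imports "HOL-Analysis.Lebesgue_Measure" "Jordan_Normal_Form.Char_Poly"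
begin

definition pauli_x :: "complex mat" where
  "pauli_x = mat_of_rows_list 2 [[0, 1], [1, 0]]"

definition pauli_y :: "complex mat" where
  "pauli_y = mat_of_rows_list 2 [[0, - \<i>], [\<i>, 0]]"

definition pauli_z :: "complex mat" where
  "pauli_z = mat_of_rows_list 2 [[1, 0], [0, - 1]]"

text \<open>Kronecker product: the matrix of the tensor product of two operators in the product
  basis, ordered lexicographically.\<close>

definition kron :: "complex mat \<Rightarrow> complex mat \<Rightarrow> complex mat" where
  "kron A B = mat (dim_row A * dim_row B) (dim_col A * dim_col B)
     (\<lambda>(r, c). A $$ (r div dim_row B, c div dim_col B) * B $$ (r mod dim_row B, c mod dim_col B))"

text \<open>For \<open>1 \<le> j \<le> N\<close>: the \<open>2 \<times> 2\<close> matrix \<open>S\<close> on tensor factor \<open>j\<close> of the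
  \<open>N\<close>-fold tensor power of \<open>\<complex>\<^sup>2\<close>, the identity on the others.\<close>

definition on_site :: "nat \<Rightarrow> nat \<Rightarrow> complex mat \<Rightarrow> complex mat" where
  "on_site N j S = kron (kron (1\<^sub>m (2 ^ (j - 1))) S) (1\<^sub>m (2 ^ (N - j)))"

text \<open>Sum of a family of \<open>n \<times> n\<close> matrices. The type of matrices of all dimensions has no
  zero element, so the library's \<open>sum\<close> is not available for it.\<close>

definition mat_sum :: "nat \<Rightarrow> ('i \<Rightarrow> complex mat) \<Rightarrow> 'i set \<Rightarrow> complex mat" where
  "mat_sum n F I = mat n n (\<lambda>(r, c). \<Sum>i\<in>I. F i $$ (r, c))"

text \<open>Names of the real parameters \<open>\<gamma>\<^sub>j\<^sup>x\<close>, \<open>\<gamma>\<^sub>j\<^sup>z\<close>, \<open>\<gamma>\<^sub>j\<^sup>z\<^sup>z\<close>; for \<open>N\<close> spins there are \<open>3N - 1\<close> of them.\<close>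

datatype param = GX nat | GZ nat | GZZ nat

definition params :: "nat \<Rightarrow> param set" where
  "params N = GX ` {1..N} \<union> GZ ` {1..N} \<union> GZZ ` {1..<N}"

lemma card_params: "N \<ge> 1 \<Longrightarrow> card (params N) = 3 * N - 1"
proof -
  assume "N \<ge> 1"
  have "card (params N) = card (GX ` {1..N}) + card (GZ ` {1..N}) + card (GZZ ` {1..<N})"
    unfolding params_def
    by (subst card_Un_disjoint; (subst card_Un_disjoint)?; auto)
  also have "\<dots> = N + N + (N - 1)"
    by (simp add: card_image inj_on_def)
  finally show ?thesis using \<open>N \<ge> 1\<close> by simp
qed

definition H_XXZ :: "nat \<Rightarrow> real \<Rightarrow> real \<Rightarrow> real \<Rightarrow> (param \<Rightarrow> real) \<Rightarrow> complex mat" where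
  "H_XXZ N hx hz hzz \<gamma> =
     mat_sum (2 ^ N) (\<lambda>j.
         complex_of_real (hx * \<gamma> (GX j)) \<cdot>\<^sub>m on_site N j pauli_x
       + complex_of_real (hz * \<gamma> (GZ j)) \<cdot>\<^sub>m on_site N j pauli_z) {1..N}
   + mat_sum (2 ^ N) (\<lambda>j.
         on_site N j pauli_x * on_site N (j + 1) pauli_x
       + on_site N j pauli_y * on_site N (j + 1) pauli_y
       + complex_of_real (hzz * \<gamma> (GZZ j)) \<cdot>\<^sub>m
           (on_site N j pauli_z * on_site N (j + 1) pauli_z)) {1..<N}"

text \<open>\<open>E\<close> lists the eigenvalues of \<open>A\<close> with multiplicity; it is unique up to order.\<close>

definition eigenvalue_list :: "complex mat \<Rightarrow> complex list \<Rightarrow> bool" where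
  "eigenvalue_list A E \<longleftrightarrow> char_poly A = (\<Prod>e\<leftarrow>E. [:- e, 1:])"

definition nondegenerate_gaps :: "complex mat \<Rightarrow> bool" where
  "nondegenerate_gaps A \<longleftrightarrow> (\<exists>E. eigenvalue_list A E \<and>
     (\<forall>j < length E. \<forall>k < length E. \<forall>j' < length E. \<forall>k' < length E.
        j \<noteq> k \<and> E ! j - E ! k = E ! j' - E ! k' \<longrightarrow> j = j' \<and> k = k'))"

text \<open>Lebesgue measure on \<open>\<real>\<^sup>I\<close> for a finite index set \<open>I\<close>; the points are the functions
  that are \<open>undefined\<close> outside \<open>I\<close>.\<close>

definition lebesgue_on_coords :: "'i set \<Rightarrow> ('i \<Rightarrow> real) measure" where
  "lebesgue_on_coords I = completion (Pi\<^sub>M I (\<lambda>_. lborel))"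

end

theory Submission
  imports Defs "HOL-Computational_Algebra.Polynomial_FPS"
begin

text \<open>Whether a matrix has non-degenerate gaps is decided by a polynomial in its entries: among the
  differences of energy gaps some vanish identically, and the product of the remaining ones is the
  last coefficient of \<open>\<Prod>(1 - d X)\<close>, hence by Newton's identities a polynomial in power sums of
  eigenvalues. As the zero set of a nonzero polynomial is a null set, one good parameter point
  suffices, and by scaling it may be sought for the Ising chain without the hopping terms
  \<open>\<sigma>\<^sup>x \<sigma>\<^sup>x + \<sigma>\<^sup>y \<sigma>\<^sup>y\<close>.

  A spin without transverse field attached to the left end splits that chain into two copies of the
  old one, with different longitudinal fields \<open>b \<plusminus> c\<close> at its first site and shifted far apart. The gaps
  of the sum are non-degenerate if those of the copies are and if no gap of one copy occurs in the
  other. So the induction on \<open>N\<close> also carries the claim that two values of the first longitudinal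
  field give chains without common gaps. For the longer chain, compare a field \<open>\<beta> \<rightarrow> \<infinity>\<close> on the new spin,
  where the bounded gaps tend to those of the old chain at \<open>b \<plusminus> c\<close>, with a fixed longitudinal field
  and a transverse field \<open>\<alpha> \<rightarrow> \<infinity>\<close>, where they tend to those of the old chain at \<open>b\<close>.\<close>

section \<open>Polynomials in the entries of a matrix\<close>

lemma nth_mult_one_minus_X:
  fixes F :: "'a::comm_ring_1 fps"
  shows "fps_nth (F * (1 - fps_const c * fps_X)) (Suc k) = fps_nth F (Suc k) - c * fps_nth F k"
proof -
  have "F * (1 - fps_const c * fps_X) = F - fps_const c * (F * fps_X)"
    by (simp add: algebra_simps)
  then show ?thesis by simp
qed

lemma nth_0_prod:
  fixes d :: "'q \<Rightarrow> 'a::comm_ring_1"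
  shows "fps_nth (\<Prod>q\<in>S. 1 - fps_const (d q) * fps_X) 0 = 1"
  by (induction S rule: infinite_finite_induct) auto

text \<open>The product is a polynomial of degree at most \<open>card S\<close>. Both parts go
  through one induction: the new top coefficient is the old one times \<open>- d x\<close> only
  because the old product has no coefficient beyond its degree.\<close>

lemma nth_prod_one_minus_X:
  fixes d :: "'q \<Rightarrow> 'a::comm_ring_1"
  assumes "finite S"
  shows "fps_nth (\<Prod>q\<in>S. 1 - fps_const (d q) * fps_X) (card S) = (\<Prod>q\<in>S. - d q)"
    and "card S < k \<Longrightarrow> fps_nth (\<Prod>q\<in>S. 1 - fps_const (d q) * fps_X) k = 0"
  using assms
proof (induction arbitrary: k rule: finite_induct)
  case empty
  { case 1 show ?case by simp next case 2 then show ?case by simp }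
next
  case (insert x S)
  have e: "(\<Prod>q\<in>insert x S. 1 - fps_const (d q) * fps_X)
      = (\<Prod>q\<in>S. 1 - fps_const (d q) * fps_X) * (1 - fps_const (d x) * fps_X)"
    using insert by (simp add: mult.commute)
  { case 1 show ?case unfolding e using insert by (simp add: nth_mult_one_minus_X)
  next
    case 2
    then obtain m where "k = Suc m" "card S < m" using insert by (cases k) auto
    then show ?case unfolding e using insert by (simp add: nth_mult_one_minus_X) }
qed

text \<open>Newton's identities, read off from the logarithmic derivative.\<close>

lemma newton_identity_fps:
  fixes d :: "'q \<Rightarrow> 'a::comm_ring_1"
  assumes "finite S"
  defines "F \<equiv> \<Prod>q\<in>S. 1 - fps_const (d q) * fps_X"
  shows "fps_deriv F = - (F * Abs_fps (\<lambda>k. \<Sum>q\<in>S. d q ^ Suc k))"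
  unfolding F_def using assms(1)
proof (induction rule: finite_induct)
  case empty
  show ?case by (intro fps_ext) simp
next
  case (insert x S)
  let ?F = "\<Prod>q\<in>S. 1 - fps_const (d q) * fps_X"
  let ?G = "Abs_fps (\<lambda>k. \<Sum>q\<in>S. d q ^ Suc k)"
  let ?g = "Abs_fps (\<lambda>k. d x ^ Suc k)"
  \<comment> \<open>\<open>?g\<close> is the geometric series of \<open>d x / (1 - d x X)\<close>,
    the negative logarithmic derivative of the new factor.\<close>
  have g: "?g * (1 - fps_const (d x) * fps_X) = fps_const (d x)"
  proof (rule fps_ext)
    fix n show "fps_nth (?g * (1 - fps_const (d x) * fps_X)) n = fps_nth (fps_const (d x)) n"
      by (cases n) (simp_all add: nth_mult_one_minus_X)
  qed
  have G: "Abs_fps (\<lambda>k. \<Sum>q\<in>insert x S. d q ^ Suc k) = ?g + ?G"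
    using insert by (intro fps_ext) simp
  have e: "(\<Prod>q\<in>insert x S. 1 - fps_const (d q) * fps_X) = ?F * (1 - fps_const (d x) * fps_X)"
    using insert by (simp add: mult.commute)
  have "fps_deriv (?F * (1 - fps_const (d x) * fps_X)) =
      - (?F * ?G) * (1 - fps_const (d x) * fps_X) - ?F * fps_const (d x)"
    using insert.IH by (simp flip: fps_const_neg)
  also have "\<dots> = - (?F * ?G) * (1 - fps_const (d x) * fps_X) - ?F * (?g * (1 - fps_const (d x) * fps_X))"
    unfolding g ..
  also have "\<dots> = - ((?F * (1 - fps_const (d x) * fps_X)) * (?g + ?G))"
    by (simp add: algebra_simps)
  finally show ?case unfolding e G .
qed

corollary newton_identity:
  fixes d :: "'q \<Rightarrow> 'a::comm_ring_1"
  assumes "finite S"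
  defines "F \<equiv> \<Prod>q\<in>S. 1 - fps_const (d q) * fps_X"
  shows "of_nat (Suc k) * fps_nth F (Suc k)
           = - (\<Sum>i\<le>k. fps_nth F i * (\<Sum>q\<in>S. d q ^ Suc (k - i)))"
proof -
  have "of_nat (Suc k) * fps_nth F (Suc k) = fps_nth (fps_deriv F) k" by simp
  also have "\<dots> = - (\<Sum>i=0..k. fps_nth F i * (\<Sum>q\<in>S. d q ^ Suc (k - i)))"
    unfolding F_def newton_identity_fps[OF assms(1)] by (simp add: fps_mult_nth)
  finally show ?thesis by (simp add: atLeast0AtMost)
qed

text \<open>An abstract algebra lets the symmetric function argument serve twice: for polynomials in
  all parameters, where nonzero ones vanish on null sets, and for polynomials in one real variable,
  where they vanish on finite sets.\<close>

locale function_algebra =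
  fixes P :: "('a \<Rightarrow> complex) set"
  assumes const [intro]: "(\<lambda>_. c) \<in> P"
    and add [intro]: "f \<in> P \<Longrightarrow> g \<in> P \<Longrightarrow> (\<lambda>x. f x + g x) \<in> P"
    and mult [intro]: "f \<in> P \<Longrightarrow> g \<in> P \<Longrightarrow> (\<lambda>x. f x * g x) \<in> P"
begin

lemma uminus [intro]: "f \<in> P \<Longrightarrow> (\<lambda>x. - f x) \<in> P"
  using mult[OF const[of "-1"]] by fastforce

lemma diff [intro]: "f \<in> P \<Longrightarrow> g \<in> P \<Longrightarrow> (\<lambda>x. f x - g x) \<in> P"
  using add[OF _ uminus] by fastforce

lemma sum [intro]: "(\<And>i. i \<in> I \<Longrightarrow> f i \<in> P) \<Longrightarrow> (\<lambda>x. \<Sum>i\<in>I. f i x) \<in> P"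
  by (induction I rule: infinite_finite_induct) auto

lemma prod [intro]: "(\<And>i. i \<in> I \<Longrightarrow> f i \<in> P) \<Longrightarrow> (\<lambda>x. \<Prod>i\<in>I. f i x) \<in> P"
  by (induction I rule: infinite_finite_induct) auto

text \<open>Polynomials with coefficients in \<open>P\<close>: inside the Leibniz formula for the
  characteristic polynomial the entries are themselves polynomials.\<close>

definition poly_algebra :: "('a \<Rightarrow> complex poly) set" where
  "poly_algebra = {F. \<forall>k. (\<lambda>x. coeff (F x) k) \<in> P}"

lemma poly_algebra_const: "(\<lambda>_. c) \<in> poly_algebra"
  by (auto simp: poly_algebra_def)

lemma poly_algebra_mult:
  "F \<in> poly_algebra \<Longrightarrow> G \<in> poly_algebra \<Longrightarrow> (\<lambda>x. F x * G x) \<in> poly_algebra"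
  by (simp add: poly_algebra_def coeff_mult sum mult)

lemma poly_algebra_sum:
  "(\<And>i. i \<in> I \<Longrightarrow> F i \<in> poly_algebra) \<Longrightarrow> (\<lambda>x. \<Sum>i\<in>I. F i x) \<in> poly_algebra"
  by (simp add: poly_algebra_def coeff_sum sum)

lemma poly_algebra_prod:
  "(\<And>i. i \<in> I \<Longrightarrow> F i \<in> poly_algebra) \<Longrightarrow> (\<lambda>x. \<Prod>i\<in>I. F i x) \<in> poly_algebra"
  by (induction I rule: infinite_finite_induct) (auto intro: poly_algebra_const poly_algebra_mult)

text \<open>The Leibniz formula builds the characteristic polynomial by sums and products from
  entries of degree at most 1 whose coefficients lie in \<open>P\<close>.\<close>

lemma coeff_char_poly:
  assumes A: "\<And>x. A x \<in> carrier_mat n n"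
    and P: "\<And>i j. i < n \<Longrightarrow> j < n \<Longrightarrow> (\<lambda>x. A x $$ (i, j)) \<in> P"
  shows "(\<lambda>x. coeff (char_poly (A x)) k) \<in> P"
proof -
  have e: "char_poly (A x) = (\<Sum>p | p permutes {0..<n}. signof p *
      (\<Prod>i = 0..<n. (if i = p i then [:- (A x $$ (i, p i)), 1:] else [:- (A x $$ (i, p i)):])))" for x
  proof -
    have "char_poly_matrix (A x) $$ (i, p i) =
        (if i = p i then [:- (A x $$ (i, p i)), 1:] else [:- (A x $$ (i, p i)):])"
      if "p permutes {0..<n}" "i \<in> {0..<n}" for p i
      using A[of x] that permutes_in_image[OF that(1), of i] by (auto simp: char_poly_matrix_def)
    then show ?thesis
      unfolding char_poly_def det_def'[OF char_poly_matrix_closed[OF A]] by auto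
  qed
  have entry: "(\<lambda>x. if i = p i then [:- (A x $$ (i, p i)), 1:] else [:- (A x $$ (i, p i)):])
      \<in> poly_algebra" if "p permutes {0..<n}" "i \<in> {0..<n}" for p i
  proof -
    have m: "(\<lambda>x. - A x $$ (i, p i)) \<in> P"
      using that permutes_in_image[OF that(1), of i] by (intro uminus P) auto
    show ?thesis
      unfolding poly_algebra_def mem_Collect_eq
    proof
      fix k show "(\<lambda>x. coeff (if i = p i then [:- A x $$ (i, p i), 1:]
          else [:- A x $$ (i, p i):]) k) \<in> P"
        by (cases k; cases "k - 1"; cases "i = p i") (use m in \<open>simp_all add: const\<close>)
    qed
  qed
  have "(\<lambda>x. char_poly (A x)) \<in> poly_algebra"
    unfolding e by (intro poly_algebra_sum poly_algebra_mult poly_algebra_const poly_algebra_prod entry) auto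
  then show ?thesis by (auto simp: poly_algebra_def)
qed

text \<open>Newton's identity expresses each coefficient through earlier ones and power sums, after
  a division by \<open>Suc m\<close> that is possible over the complex numbers.\<close>

lemma nth_prod_from_power_sums:
  assumes S: "finite S" and p: "\<And>k. (\<lambda>x. \<Sum>q\<in>S. d x q ^ k) \<in> P"
  shows "(\<lambda>x. fps_nth (\<Prod>q\<in>S. 1 - fps_const (d x q) * fps_X) k) \<in> P"
proof (induction k rule: less_induct)
  case (less k)
  show ?case
  proof (cases k)
    case 0
    then show ?thesis by (simp add: nth_0_prod const)
  next
    case (Suc m)
    let ?F = "\<lambda>x. \<Prod>q\<in>S. 1 - fps_const (d x q) * fps_X"
    have "fps_nth (?F x) (Suc m) = (- 1 / of_nat (Suc m)) *
        (\<Sum>i\<le>m. fps_nth (?F x) i * (\<Sum>q\<in>S. d x q ^ Suc (m - i)))" for x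
      using newton_identity[OF S, of m "d x"] by (simp add: field_simps del: of_nat_Suc)
    moreover have "(\<lambda>x. (- 1 / of_nat (Suc m)) *
        (\<Sum>i\<le>m. fps_nth (?F x) i * (\<Sum>q\<in>S. d x q ^ Suc (m - i)))) \<in> P"
      using less Suc by (intro mult const, intro sum, intro mult p) auto
    ultimately show ?thesis using Suc by simp
  qed
qed

text \<open>Newton's identity read in the other direction: the term \<open>i = 0\<close> holds the
  power sum of exponent \<open>Suc m\<close> with coefficient 1, and the other terms hold power sums
  of smaller exponent.\<close>

lemma power_sums_from_nth_prod:
  assumes S: "finite S" and F: "\<And>k. (\<lambda>x. fps_nth (\<Prod>q\<in>S. 1 - fps_const (d x q) * fps_X) k) \<in> P"
  shows "(\<lambda>x. \<Sum>q\<in>S. d x q ^ k) \<in> P"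
proof (induction k rule: less_induct)
  case (less k)
  show ?case
  proof (cases k)
    case 0
    then show ?thesis by (simp add: const)
  next
    case (Suc m)
    let ?F = "\<lambda>x. \<Prod>q\<in>S. 1 - fps_const (d x q) * fps_X"
    have "(\<Sum>q\<in>S. d x q ^ Suc m) = - (of_nat (Suc m) * fps_nth (?F x) (Suc m)) -
        (\<Sum>i\<in>{1..m}. fps_nth (?F x) i * (\<Sum>q\<in>S. d x q ^ Suc (m - i)))" for x
    proof -
      have "{..m} = insert 0 {1..m}" by auto
      then have "(\<Sum>i\<le>m. fps_nth (?F x) i * (\<Sum>q\<in>S. d x q ^ Suc (m - i)))
         = fps_nth (?F x) 0 * (\<Sum>q\<in>S. d x q ^ Suc m)
           + (\<Sum>i\<in>{1..m}. fps_nth (?F x) i * (\<Sum>q\<in>S. d x q ^ Suc (m - i)))"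
        by simp
      moreover have "fps_nth (?F x) 0 = 1" by (simp add: nth_0_prod)
      ultimately show ?thesis using newton_identity[OF S, of m "d x"] by (simp del: of_nat_Suc)
    qed
    moreover have "(\<lambda>x. - (of_nat (Suc m) * fps_nth (?F x) (Suc m)) -
        (\<Sum>i\<in>{1..m}. fps_nth (?F x) i * (\<Sum>q\<in>S. d x q ^ Suc (m - i)))) \<in> P"
      by (intro diff uminus mult const F, intro sum, intro mult F, rule less) (use Suc in auto)
    ultimately show ?thesis using Suc by simp
  qed
qed

text \<open>Binomial expansion separates the two families: a power sum of the differences is a
  combination of products of one power sum of \<open>u\<close> and one of \<open>v\<close>.\<close>

lemma power_sums_diff:
  assumes u: "\<And>k. (\<lambda>x. \<Sum>s\<in>S. u x s ^ k) \<in> P" and v: "\<And>k. (\<lambda>x. \<Sum>t\<in>T. v x t ^ k) \<in> P"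
  shows "(\<lambda>x. \<Sum>(s, t)\<in>S \<times> T. (u x s - v x t) ^ k) \<in> P"
proof -
  have "(\<Sum>(s, t)\<in>S \<times> T. (u x s - v x t) ^ k) =
     (\<Sum>i\<le>k. of_nat (k choose i) * ((\<Sum>s\<in>S. u x s ^ i) * ((-1) ^ (k - i) * (\<Sum>t\<in>T. v x t ^ (k - i)))))" for x
  proof -
    have "(\<Sum>(s, t)\<in>S \<times> T. (u x s - v x t) ^ k) =
      (\<Sum>(s, t)\<in>S \<times> T. \<Sum>i\<le>k. of_nat (k choose i) * u x s ^ i * ((- 1) ^ (k - i) * v x t ^ (k - i)))"
    proof (intro sum.cong refl, clarify)
      fix s t
      have "(u x s - v x t) ^ k = (u x s + - v x t) ^ k" by simp
      also have "\<dots> = (\<Sum>i\<le>k. of_nat (k choose i) * u x s ^ i * (- v x t) ^ (k - i))"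
        by (rule binomial_ring)
      also have "\<dots> = (\<Sum>i\<le>k. of_nat (k choose i) * u x s ^ i * ((- 1) ^ (k - i) * v x t ^ (k - i)))"
        by (intro sum.cong refl) (simp add: power_minus[of "v x t"])
      finally show "(u x s - v x t) ^ k = \<dots>" .
    qed
    also have "\<dots> = (\<Sum>i\<le>k. \<Sum>(s, t)\<in>S \<times> T. of_nat (k choose i) * u x s ^ i * ((- 1) ^ (k - i) * v x t ^ (k - i)))"
      unfolding case_prod_unfold by (rule sum.swap)
    also have "\<dots> = (\<Sum>i\<le>k. of_nat (k choose i) * ((\<Sum>s\<in>S. u x s ^ i) * ((-1) ^ (k - i) * (\<Sum>t\<in>T. v x t ^ (k - i)))))"
      by (simp only: sum_distrib_left[of "(-1) ^ _"] sum_product, simp only: sum_distrib_left mult.assoc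
          sum.cartesian_product[symmetric])
    finally show ?thesis .
  qed
  then show ?thesis
    using u v by (simp add: sum mult const)
qed

text \<open>A single eigenvalue need not depend polynomially on \<open>x\<close>, and
  \<open>E x\<close> may be ordered arbitrarily for each \<open>x\<close>, but power sums are
  symmetric. Reversing the characteristic polynomial turns its factors \<open>X - e\<close> into
  \<open>1 - e X\<close>, so its coefficients yield the power sums.\<close>

lemma eigenvalue_power_sums:
  assumes A: "\<And>x. A x \<in> carrier_mat n n"
    and P: "\<And>i j. i < n \<Longrightarrow> j < n \<Longrightarrow> (\<lambda>x. A x $$ (i, j)) \<in> P"
    and E: "\<And>x. eigenvalue_list (A x) (E x)" and len: "\<And>x. length (E x) = n"
  shows "(\<lambda>x. \<Sum>i<n. (E x ! i) ^ k) \<in> P"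
proof (rule power_sums_from_nth_prod)
  fix k
  have "(\<Prod>i<n. 1 - fps_const (E x ! i) * fps_X) = fps_of_poly (reflect_poly (char_poly (A x)))" for x
  proof -
    have "char_poly (A x) = (\<Prod>i<n. [:- (E x ! i), 1:])"
      using E[of x] len[of x] by (simp add: eigenvalue_list_def prod.list_conv_set_nth atLeast0LessThan)
    moreover have "reflect_poly [:- e, 1:] = [:1, - e:]" for e :: complex
      by (cases "e = 0") (simp_all add: reflect_poly_def)
    ultimately have "reflect_poly (char_poly (A x)) = (\<Prod>i<n. [:1, - (E x ! i):])"
      by (simp add: reflect_poly_prod)
    then show ?thesis
      by (simp add: fps_of_poly_prod fps_of_poly_pCons flip: fps_const_neg)
  qed
  moreover have "degree (char_poly (A x)) = n" for x
    using degree_monic_char_poly[OF A] by auto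
  ultimately have "(\<lambda>x. fps_nth (\<Prod>i<n. 1 - fps_const (E x ! i) * fps_X) k) =
      (\<lambda>x. if n < k then 0 else coeff (char_poly (A x)) (n - k))"
    by (intro ext) (simp add: coeff_reflect_poly)
  also have "\<dots> \<in> P" using coeff_char_poly[OF A P] const by (cases "n < k") auto
  finally show "(\<lambda>x. fps_nth (\<Prod>i<n. 1 - fps_const (E x ! i) * fps_X) k) \<in> P" .
qed auto

text \<open>The product of the values off \<open>U\<close> is the last coefficient that can be nonzero in
  \<open>\<Prod>(1 - d X)\<close>; it is therefore a polynomial in the power sums although the product over
  \<open>S - U\<close> alone is not visibly symmetric.\<close>

lemma product_off_trivial:
  assumes S: "finite S" "U \<subseteq> S" and p: "\<And>k. (\<lambda>x. \<Sum>q\<in>S. d x q ^ k) \<in> P"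
    and U: "\<And>x q. q \<in> U \<Longrightarrow> d x q = 0"
  shows "(\<lambda>x. \<Prod>q\<in>S - U. - d x q) \<in> P"
proof -
  have "(\<Prod>q\<in>S - U. - d x q) = fps_nth (\<Prod>q\<in>S. 1 - fps_const (d x q) * fps_X) (card (S - U))" for x
  proof -
    have "(\<Prod>q\<in>S. 1 - fps_const (d x q) * fps_X) = (\<Prod>q\<in>S - U. 1 - fps_const (d x q) * fps_X)"
      using S U by (intro prod.mono_neutral_right) auto
    then show ?thesis using S nth_prod_one_minus_X(1)[of "S - U" "d x"] by simp
  qed
  then show ?thesis using nth_prod_from_power_sums[OF S(1) p] by simp
qed

text \<open>\<open>U\<close> holds index quadruples whose gaps agree for every \<open>x\<close>.
  With their vanishing factors removed, the product of the remaining differences is nonzero exactly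
  when no further coincidence occurs.\<close>

lemma gap_difference_product:
  fixes A B :: "'a \<Rightarrow> complex mat"
  assumes A: "\<And>x. A x \<in> carrier_mat n n" "\<And>i j. i < n \<Longrightarrow> j < n \<Longrightarrow> (\<lambda>x. A x $$ (i, j)) \<in> P"
    and B: "\<And>x. B x \<in> carrier_mat m m" "\<And>i j. i < m \<Longrightarrow> j < m \<Longrightarrow> (\<lambda>x. B x $$ (i, j)) \<in> P"
    and E: "\<And>x. eigenvalue_list (A x) (E x)" "\<And>x. length (E x) = n"
    and F: "\<And>x. eigenvalue_list (B x) (F x)" "\<And>x. length (F x) = m"
    and U: "U \<subseteq> ({..<n} \<times> {..<n}) \<times> ({..<m} \<times> {..<m})"
      "\<And>x j k p q. ((j, k), (p, q)) \<in> U \<Longrightarrow> E x ! j - E x ! k = F x ! p - F x ! q"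
  obtains D where "D \<in> P"
    "\<And>x. D x \<noteq> 0 \<longleftrightarrow> (\<forall>j<n. \<forall>k<n. \<forall>p<m. \<forall>q<m.
       E x ! j - E x ! k = F x ! p - F x ! q \<longrightarrow> ((j, k), (p, q)) \<in> U)"
proof -
  let ?S = "({..<n} \<times> {..<n}) \<times> ({..<m} \<times> {..<m})"
  define d where "d = (\<lambda>x ((j, k), (p, q)). (E x ! j - E x ! k) - (F x ! p - F x ! q))"
  define D where "D = (\<lambda>x. \<Prod>t\<in>?S - U. - d x t)"
  note ps = eigenvalue_power_sums[OF A E] eigenvalue_power_sums[OF B F]
  \<comment> \<open>Power sums pass from eigenvalues to gaps, and then from gaps to differences of
    gaps.\<close>
  have "(\<lambda>x. \<Sum>(s, t)\<in>?S. ((case s of (j, k) \<Rightarrow> E x ! j - E x ! k) -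
       (case t of (p, q) \<Rightarrow> F x ! p - F x ! q)) ^ k) \<in> P" for k
    by (intro power_sums_diff)
      (use power_sums_diff[OF ps(1) ps(1)] power_sums_diff[OF ps(2) ps(2)] in
        \<open>simp_all add: case_prod_unfold\<close>)
  then have "(\<lambda>x. \<Sum>t\<in>?S. d x t ^ k) \<in> P" for k
    by (simp add: d_def case_prod_unfold)
  then have "D \<in> P"
    unfolding D_def using U by (intro product_off_trivial) (auto simp: d_def)
  moreover have "D x \<noteq> 0 \<longleftrightarrow> (\<forall>j<n. \<forall>k<n. \<forall>p<m. \<forall>q<m.
       E x ! j - E x ! k = F x ! p - F x ! q \<longrightarrow> ((j, k), (p, q)) \<in> U)" for x
  proof -
    have "D x \<noteq> 0 \<longleftrightarrow> (\<forall>t\<in>?S - U. d x t \<noteq> 0)" unfolding D_def by simp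
    also have "\<dots> \<longleftrightarrow> (\<forall>t\<in>?S. d x t = 0 \<longrightarrow> t \<in> U)" by blast
    finally show ?thesis by (auto simp: d_def Ball_def)
  qed
  ultimately show ?thesis using that by blast
qed

end

section \<open>Lists of eigenvalues and polynomial criteria for gap conditions\<close>

lemma eigenvalue_list_exists:
  assumes "A \<in> carrier_mat n n"
  obtains E where "eigenvalue_list A E" "length E = n"
  using char_poly_factorized[OF assms] by (auto simp: eigenvalue_list_def)

lemma length_eigenvalue_list:
  assumes A: "A \<in> carrier_mat n n" and E: "eigenvalue_list A E"
  shows "length E = n"
proof -
  have "degree (char_poly A) = length E"
    using E by (simp add: eigenvalue_list_def degree_linear_factors)
  then show ?thesis using degree_monic_char_poly[OF A] by simp
qed

lemma set_eigenvalue_list: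
  assumes A: "A \<in> carrier_mat n n" and E: "eigenvalue_list A E"
  shows "set E = {x. eigenvalue A x}"
proof -
  have "poly (\<Prod>e\<leftarrow>E. [:- e, 1:]) x = 0 \<longleftrightarrow> x \<in> set E" for x
    by (induction E) auto
  then show ?thesis
    using eigenvalue_root_char_poly[OF A] E by (auto simp: eigenvalue_list_def)
qed

text \<open>For nonempty spectra this includes that both are simple: take \<open>j = k\<close> or \<open>p = q\<close>.\<close>

definition gap_independent :: "complex mat \<Rightarrow> complex mat \<Rightarrow> bool" where
  "gap_independent A B \<longleftrightarrow> (\<exists>E F. eigenvalue_list A E \<and> eigenvalue_list B F \<and>
     (\<forall>j<length E. \<forall>k<length E. \<forall>p<length F. \<forall>q<length F.
        E ! j - E ! k = F ! p - F ! q \<longrightarrow> j = k \<and> p = q))"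

context function_algebra
begin

lemma nondegenerate_gaps_polynomial:
  assumes A: "\<And>x. A x \<in> carrier_mat n n" "\<And>i j. i < n \<Longrightarrow> j < n \<Longrightarrow> (\<lambda>x. A x $$ (i, j)) \<in> P"
  obtains D where "D \<in> P" "\<And>x. D x \<noteq> 0 \<longleftrightarrow> nondegenerate_gaps (A x)"
proof -
  let ?good = "\<lambda>E. \<forall>j < length E. \<forall>k < length E. \<forall>j' < length E. \<forall>k' < length E.
        j \<noteq> k \<and> E ! j - E ! k = E ! j' - E ! k' \<longrightarrow> j = j' \<and> k = k'"
  \<comment> \<open>The definition asks for some list, so a list with good gaps is chosen wherever
    there is one; this avoids comparing different orderings.\<close>
  have "\<exists>E. eigenvalue_list (A x) E \<and> (nondegenerate_gaps (A x) \<longrightarrow> ?good E)" for x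
    unfolding nondegenerate_gaps_def using eigenvalue_list_exists[OF A(1)[of x]] by metis
  then obtain E where E: "\<And>x. eigenvalue_list (A x) (E x)"
    and good: "\<And>x. nondegenerate_gaps (A x) \<Longrightarrow> ?good (E x)" by metis
  have len: "length (E x) = n" for x using length_eigenvalue_list[OF A(1) E] .
  \<comment> \<open>Gaps agree identically if both are zero or if they belong to the same ordered
    pair.\<close>
  let ?U = "{((j, k), (p, q)). j < n \<and> k < n \<and> p < n \<and> q < n \<and> (j = k \<and> p = q \<or> j = p \<and> k = q)}"
  obtain D where D: "D \<in> P" "\<And>x. D x \<noteq> 0 \<longleftrightarrow> (\<forall>j<n. \<forall>k<n. \<forall>p<n. \<forall>q<n.
       E x ! j - E x ! k = E x ! p - E x ! q \<longrightarrow> ((j, k), (p, q)) \<in> ?U)"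
    by (rule gap_difference_product[OF A A E len E len, of ?U]) auto
  have "D x \<noteq> 0 \<longleftrightarrow> nondegenerate_gaps (A x)" for x
  proof
    assume nz: "D x \<noteq> 0"
    have "?good (E x)"
      unfolding len
    proof (intro allI impI, elim conjE)
      fix j k p q assume *: "j < n" "k < n" "p < n" "q < n" "j \<noteq> k" "E x ! j - E x ! k = E x ! p - E x ! q"
      then show "j = p \<and> k = q" using nz unfolding D(2) by blast
    qed
    then show "nondegenerate_gaps (A x)" unfolding nondegenerate_gaps_def using E by blast
  next
    assume "nondegenerate_gaps (A x)"
    note g = good[OF this, unfolded len]
    show "D x \<noteq> 0"
      unfolding D(2)
    proof (intro allI impI)
      fix j k p q assume *: "j < n" "k < n" "p < n" "q < n" "E x ! j - E x ! k = E x ! p - E x ! q"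
      show "((j, k), (p, q)) \<in> ?U"
      proof (cases "j = k")
        case True
        then have "E x ! p - E x ! q = E x ! j - E x ! j" using * by simp
        \<comment> \<open>If \<open>p \<noteq> q\<close>, the gap condition for \<open>p, q\<close>
          against \<open>j, j\<close> would force \<open>p = j = q\<close>.\<close>
        then have "p = q" using g * by blast
        then show ?thesis using * True by simp
      next
        case False
        then show ?thesis using g * by blast
      qed
    qed
  qed
  then show ?thesis using that D(1) by blast
qed

text \<open>The same construction for two spectra, possibly of different sizes; the only
  coincidences discarded in advance are those of two zero gaps.\<close>

lemma gap_independent_polynomial:
  assumes A: "\<And>x. A x \<in> carrier_mat n n" "\<And>i j. i < n \<Longrightarrow> j < n \<Longrightarrow> (\<lambda>x. A x $$ (i, j)) \<in> P"
    and B: "\<And>x. B x \<in> carrier_mat m m" "\<And>i j. i < m \<Longrightarrow> j < m \<Longrightarrow> (\<lambda>x. B x $$ (i, j)) \<in> P"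
  obtains D where "D \<in> P" "\<And>x. D x \<noteq> 0 \<longleftrightarrow> gap_independent (A x) (B x)"
proof -
  let ?good = "\<lambda>E F. \<forall>j<length E. \<forall>k<length E. \<forall>p<length F. \<forall>q<length F.
        E ! j - E ! k = F ! p - F ! q \<longrightarrow> j = k \<and> p = q"
  have "\<exists>E F. eigenvalue_list (A x) E \<and> eigenvalue_list (B x) F \<and>
     (gap_independent (A x) (B x) \<longrightarrow> ?good E F)" for x
    unfolding gap_independent_def
    using eigenvalue_list_exists[OF A(1)[of x]] eigenvalue_list_exists[OF B(1)[of x]] by metis
  then obtain E F where E: "\<And>x. eigenvalue_list (A x) (E x)" and F: "\<And>x. eigenvalue_list (B x) (F x)"
    and good: "\<And>x. gap_independent (A x) (B x) \<Longrightarrow> ?good (E x) (F x)" by metis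
  have lE: "length (E x) = n" for x using length_eigenvalue_list[OF A(1) E] .
  have lF: "length (F x) = m" for x using length_eigenvalue_list[OF B(1) F] .
  let ?U = "{((j, k), (p, q)). j < n \<and> k < n \<and> p < m \<and> q < m \<and> j = k \<and> p = q}"
  obtain D where D: "D \<in> P" "\<And>x. D x \<noteq> 0 \<longleftrightarrow> (\<forall>j<n. \<forall>k<n. \<forall>p<m. \<forall>q<m.
       E x ! j - E x ! k = F x ! p - F x ! q \<longrightarrow> ((j, k), (p, q)) \<in> ?U)"
    by (rule gap_difference_product[OF A B E lE F lF, of ?U]) auto
  have "D x \<noteq> 0 \<longleftrightarrow> gap_independent (A x) (B x)" for x
  proof
    assume nz: "D x \<noteq> 0"
    have "?good (E x) (F x)"
      unfolding lE lF
    proof (intro allI impI)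
      fix j k p q assume "j < n" "k < n" "p < m" "q < m" "E x ! j - E x ! k = F x ! p - F x ! q"
      then show "j = k \<and> p = q" using nz[unfolded D(2), rule_format, of j k p q] by simp
    qed
    then show "gap_independent (A x) (B x)" unfolding gap_independent_def
      by (intro exI[of _ "E x"] exI[of _ "F x"] conjI E F)
  next
    assume "gap_independent (A x) (B x)"
    note g = good[OF this, unfolded lE lF]
    show "D x \<noteq> 0"
      unfolding D(2)
    proof (intro allI impI)
      fix j k p q assume *: "j < n" "k < n" "p < m" "q < m" "E x ! j - E x ! k = F x ! p - F x ! q"
      then show "((j, k), (p, q)) \<in> ?U" using g[rule_format, of j k p q] by simp
    qed
  qed
  then show ?thesis using that D(1) by blast
qed

end

section \<open>Zero sets of polynomial functions\<close>

text \<open>Complex values match the matrix entries. Only the coordinates in \<open>I\<close> may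
  occur, which is what lets an induction remove the coordinates one at a time.\<close>

inductive_set polynomial_functions :: "'i set \<Rightarrow> (('i \<Rightarrow> real) \<Rightarrow> complex) set" for I where
  const: "(\<lambda>_. c) \<in> polynomial_functions I"
| coord: "i \<in> I \<Longrightarrow> (\<lambda>\<gamma>. of_real (\<gamma> i)) \<in> polynomial_functions I"
| add: "f \<in> polynomial_functions I \<Longrightarrow> g \<in> polynomial_functions I \<Longrightarrow>
    (\<lambda>\<gamma>. f \<gamma> + g \<gamma>) \<in> polynomial_functions I"
| mult: "f \<in> polynomial_functions I \<Longrightarrow> g \<in> polynomial_functions I \<Longrightarrow>
    (\<lambda>\<gamma>. f \<gamma> * g \<gamma>) \<in> polynomial_functions I"

interpretation polynomial_functions_algebra: function_algebra "polynomial_functions I" for I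
  by standard (auto intro: polynomial_functions.intros)

definition real_polynomials :: "(real \<Rightarrow> complex) set" where
  "real_polynomials = {f. \<exists>p. \<forall>t. f t = poly p (of_real t)}"

lemma real_polynomialsI: "(\<And>t. f t = poly p (of_real t)) \<Longrightarrow> f \<in> real_polynomials"
  by (auto simp: real_polynomials_def)

interpretation real_polynomials: function_algebra real_polynomials
proof
  fix c :: complex
  show "(\<lambda>_. c) \<in> real_polynomials" by (rule real_polynomialsI[of _ "[:c:]"]) simp
next
  fix f g :: "real \<Rightarrow> complex" assume "f \<in> real_polynomials" "g \<in> real_polynomials"
  then obtain p q where pq: "\<And>t. f t = poly p (of_real t)" "\<And>t. g t = poly q (of_real t)"
    by (auto simp: real_polynomials_def)
  show "(\<lambda>x. f x + g x) \<in> real_polynomials"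
    by (rule real_polynomialsI[of _ "p + q"]) (simp add: pq)
  show "(\<lambda>x. f x * g x) \<in> real_polynomials"
    by (rule real_polynomialsI[of _ "p * q"]) (simp add: pq)
qed

lemma real_polynomials_of_real: "complex_of_real \<in> real_polynomials"
  by (rule real_polynomialsI[of _ "[:0, 1:]"]) simp

lemma finite_zeros_real_polynomials:
  assumes "f \<in> real_polynomials" "f t \<noteq> 0"
  shows "finite {t. f t = 0}"
proof -
  obtain p where p: "\<And>t. f t = poly p (of_real t)"
    using assms by (auto simp: real_polynomials_def)
  then have "p \<noteq> 0" using assms(2) by auto
  then have "finite (complex_of_real -` {z. poly p z = 0})"
    by (intro finite_vimageI poly_roots_finite) (auto simp: inj_on_def)
  then show ?thesis by (simp add: p vimage_def)
qed

text \<open>Substitution. It serves to freeze one coordinate, which leaves a polynomial in the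
  others, and to vary one alone, which leaves a polynomial in one variable.\<close>

lemma polynomial_functions_compose:
  assumes "f \<in> polynomial_functions I" "function_algebra P"
    and "\<And>i. i \<in> I \<Longrightarrow> (\<lambda>x. complex_of_real (g x i)) \<in> P"
  shows "(\<lambda>x. f (g x)) \<in> P"
proof -
  interpret function_algebra P by fact
  show ?thesis using assms(1,3) by induction auto
qed

lemma polynomial_functions_measurable:
  assumes "f \<in> polynomial_functions I"
  shows "f \<in> borel_measurable (Pi\<^sub>M I (\<lambda>_. lborel))"
  using assms
proof induction
  case (coord i)
  have "(\<lambda>\<gamma>. \<gamma> i) \<in> borel_measurable (Pi\<^sub>M I (\<lambda>_. lborel))"
    using measurable_component_singleton[OF coord, of "\<lambda>_. lborel"] by simp
  then show ?case by measurable
qed auto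

text \<open>Induction on the number of coordinates with Fubini's theorem: for almost every choice of
  the others, the polynomial in the new coordinate takes a nonzero value and hence has only finitely
  many zeros.\<close>

lemma AE_polynomial_function_nonzero:
  assumes "finite I" "f \<in> polynomial_functions I" "f \<gamma>\<^sub>0 \<noteq> 0"
  shows "AE \<gamma> in Pi\<^sub>M I (\<lambda>_. lborel). f \<gamma> \<noteq> 0"
  using assms
proof (induction I arbitrary: f rule: finite_induct)
  case empty
  have "\<exists>c. \<forall>\<gamma>. f \<gamma> = c" using empty(1) by induction auto
  then show ?case using empty(2) by auto
next
  case (insert i I)
  interpret product_sigma_finite "\<lambda>_. lborel :: real measure"
    by standard
  let ?ind = "\<lambda>\<gamma>. indicator {\<gamma>. \<not> f \<gamma> \<noteq> 0} \<gamma> :: ennreal"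
  note meas [measurable] = polynomial_functions_measurable[OF insert.prems(1)]
  have ind: "?ind \<in> borel_measurable (Pi\<^sub>M (insert i I) (\<lambda>_. lborel))"
    by measurable
  \<comment> \<open>Freezing coordinate \<open>i\<close> at \<open>\<gamma>\<^sub>0 i\<close> keeps
    the nonzero value at \<open>\<gamma>\<^sub>0\<close>, so the induction hypothesis
    applies.\<close>
  have "(\<lambda>\<gamma>. f (\<gamma>(i := \<gamma>\<^sub>0 i))) \<in> polynomial_functions I"
  proof (rule polynomial_functions_compose[OF insert.prems(1) polynomial_functions_algebra.function_algebra_axioms])
    fix j assume "j \<in> insert i I"
    then show "(\<lambda>\<gamma>. complex_of_real ((\<gamma>(i := \<gamma>\<^sub>0 i)) j)) \<in> polynomial_functions I"
      by (cases "j = i") (simp_all add: polynomial_functions.intros)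
  qed
  then have "AE \<gamma> in Pi\<^sub>M I (\<lambda>_. lborel). f (\<gamma>(i := \<gamma>\<^sub>0 i)) \<noteq> 0"
    using insert by simp
  then have "AE \<gamma> in Pi\<^sub>M I (\<lambda>_. lborel). (\<integral>\<^sup>+ t. ?ind (\<gamma>(i := t)) \<partial>lborel) = 0"
  proof eventually_elim
    case (elim \<gamma>)
    have "(\<lambda>t. f (\<gamma>(i := t))) \<in> real_polynomials"
    proof (rule polynomial_functions_compose[OF insert.prems(1) real_polynomials.function_algebra_axioms])
      fix j show "(\<lambda>t. complex_of_real ((\<gamma>(i := t)) j)) \<in> real_polynomials"
        by (cases "j = i") (simp_all add: real_polynomials_of_real real_polynomials.const)
    qed
    then have fin: "finite {t. f (\<gamma>(i := t)) = 0}"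
      using finite_zeros_real_polynomials elim by blast
    have "(\<integral>\<^sup>+ t. ?ind (\<gamma>(i := t)) \<partial>lborel) = (\<integral>\<^sup>+ t. indicator {t. f (\<gamma>(i := t)) = 0} t \<partial>lborel)"
      by (intro nn_integral_cong) (simp add: indicator_def)
    also have "\<dots> = emeasure lborel {t. f (\<gamma>(i := t)) = 0}"
      using fin by (intro nn_integral_indicator) (simp add: borel_closed finite_imp_closed)
    also have "\<dots> = 0" using fin by (intro emeasure_lborel_countable countable_finite)
    finally show ?case .
  qed
  then have "(\<integral>\<^sup>+ \<gamma>. \<integral>\<^sup>+ t. ?ind (\<gamma>(i := t)) \<partial>lborel \<partial>Pi\<^sub>M I (\<lambda>_. lborel)) = 0"
    by (subst nn_integral_cong_AE[where v = "\<lambda>_. 0"]) auto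
  then have "integral\<^sup>N (Pi\<^sub>M (insert i I) (\<lambda>_. lborel)) ?ind = 0"
    using product_nn_integral_insert[OF insert.hyps ind] by simp
  then show ?case
    by (subst AE_iff_nn_integral) simp_all
qed

section \<open>Eigenvalues under a strong field\<close>

lemma tendsto_det:
  fixes A :: "'b \<Rightarrow> complex mat"
  assumes A: "\<And>k. A k \<in> carrier_mat m m" and L: "L \<in> carrier_mat m m"
    and lim: "\<And>i j. i < m \<Longrightarrow> j < m \<Longrightarrow> ((\<lambda>k. A k $$ (i, j)) \<longlongrightarrow> L $$ (i, j)) F"
  shows "((\<lambda>k. det (A k)) \<longlongrightarrow> det L) F"
  unfolding det_def'[OF A] det_def'[OF L]
proof (intro tendsto_sum tendsto_mult tendsto_const tendsto_prod)
  fix p i assume "p \<in> {p. p permutes {0..<m}}" "i \<in> {0..<m}"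
  then show "((\<lambda>k. A k $$ (i, p i)) \<longlongrightarrow> L $$ (i, p i)) F"
    using permutes_in_image[of p "{0..<m}" i] by (intro lim) auto
qed

text \<open>Once the rows with \<open>D i = - \<sigma>\<close> are divided by \<open>- 2 \<sigma> \<tau>\<close>, the matrix \<open>K - a\<close> converges
  entrywise.\<close>

lemma eigenvalue_limit:
  fixes K :: "complex mat" and D :: "nat \<Rightarrow> real" and \<tau> :: "nat \<Rightarrow> real"
  assumes K: "K \<in> carrier_mat m m" and \<sigma>: "\<sigma> = 1 \<or> \<sigma> = - 1"
    and D: "\<And>i. D i = \<sigma> \<or> D i = - \<sigma>"
    and \<tau>: "filterlim \<tau> at_top sequentially"
    and ev: "\<And>k. eigenvalue (K + mat_diag m (\<lambda>i. of_real (\<tau> k * D i))) (a k)"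
    and lim: "(\<lambda>k. a k - of_real (\<sigma> * \<tau> k)) \<longlonglongrightarrow> x"
  shows "det (mat m m (\<lambda>(i, j). if D i = \<sigma> then K $$ (i, j) - (if i = j then x else 0)
    else if i = j then 1 else 0)) = 0" (is "det ?L = 0")
proof -
  \<comment> \<open>In the rows with \<open>D i = - \<sigma>\<close> the diagonal entry is about
    \<open>- 2 * \<sigma> * \<tau> k\<close> and the others are bounded, so the scaled row tends to
    a unit row.\<close>
  define s where "s = (\<lambda>k i. if D i = \<sigma> then 1 else - 1 / (2 * complex_of_real (\<sigma> * \<tau> k)))"
  define C where "C = (\<lambda>k. char_matrix (K + mat_diag m (\<lambda>i. of_real (\<tau> k * D i))) (a k))"
  have C: "C k \<in> carrier_mat m m" for k
    using K by (simp add: C_def)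
  have Cij: "C k $$ (i, j) = K $$ (i, j) + (if i = j then of_real (\<tau> k * D i) - a k else 0)"
    if "i < m" "j < m" for i j k
    using K that by (simp add: C_def char_matrix_def mat_diag_def)
  define A where "A = (\<lambda>k. mat_diag m (s k) * C k)"
  have A: "A k \<in> carrier_mat m m" for k
    unfolding A_def using mult_carrier_mat[OF mat_diag_dim C] .
  have Aij: "A k $$ (i, j) = s k i * C k $$ (i, j)" if "i < m" "j < m" for i j k
    unfolding A_def mat_diag_mult_left[OF C] using that by simp
  have "det (A k) = 0" for k
  proof -
    have "det (C k) = 0"
      using ev[of k] eigenvalue_det[of "K + mat_diag m (\<lambda>i. of_real (\<tau> k * D i))" m] K
      by (simp add: C_def)
    then show ?thesis unfolding A_def using C by (simp add: det_mult[of _ m])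
  qed
  moreover have "(\<lambda>k. det (A k)) \<longlonglongrightarrow> det ?L"
  proof (rule tendsto_det[OF A])
    fix i j assume ij: "i < m" "j < m"
    define w where "w = (\<lambda>k. 1 / (2 * complex_of_real (\<sigma> * \<tau> k)))"
    have w: "w \<longlonglongrightarrow> 0"
    proof -
      have "(\<lambda>k. inverse (\<tau> k)) \<longlonglongrightarrow> 0"
        by (rule tendsto_inverse_0_at_top[OF \<tau>])
      then have "(\<lambda>k. complex_of_real (1 / (2 * \<sigma>) * inverse (\<tau> k))) \<longlonglongrightarrow> complex_of_real (1 / (2 * \<sigma>) * 0)"
        by (intro tendsto_of_real tendsto_mult tendsto_const)
      then show ?thesis by (simp add: w_def field_simps)
    qed
    show "(\<lambda>k. A k $$ (i, j)) \<longlonglongrightarrow> ?L $$ (i, j)"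
    proof (cases "D i = \<sigma>")
      case True
      have "(\<lambda>k. K $$ (i, j) - (if i = j then a k - of_real (\<sigma> * \<tau> k) else 0)) \<longlonglongrightarrow> ?L $$ (i, j)"
        using tendsto_diff[OF tendsto_const[of "K $$ (i, j)"] lim] ij True by (cases "i = j") simp_all
      moreover have "A k $$ (i, j) = K $$ (i, j) - (if i = j then a k - of_real (\<sigma> * \<tau> k) else 0)" for k
        using ij True by (cases "i = j") (simp_all add: Aij Cij s_def mult.commute)
      ultimately show ?thesis by simp
    next
      case False
      then have Di: "D i = - \<sigma>" using D[of i] by auto
      have f1: "(\<lambda>k. - w k * K $$ (i, j) + (if i = j then 1 + (a k - of_real (\<sigma> * \<tau> k)) * w k else 0))
          \<longlonglongrightarrow> - 0 * K $$ (i, j) + (if i = j then 1 + x * 0 else 0)"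
      proof -
        have t1: "(\<lambda>k. - w k * K $$ (i, j)) \<longlonglongrightarrow> - 0 * K $$ (i, j)"
          by (intro tendsto_intros w)
        have t2: "(\<lambda>k. 1 + (a k - of_real (\<sigma> * \<tau> k)) * w k) \<longlonglongrightarrow> 1 + x * 0"
          by (intro tendsto_intros w lim)
        show ?thesis using t1 tendsto_add[OF t1 t2] by (cases "i = j") (simp_all del: of_real_mult)
      qed
      have f2: "- 0 * K $$ (i, j) + (if i = j then 1 + x * 0 else 0) = ?L $$ (i, j)"
        using ij False by simp
      \<comment> \<open>The scaling has its intended meaning once \<open>\<tau> k\<close> is
        positive, so the two expressions agree only eventually.\<close>
      have f3: "\<forall>\<^sub>F k in sequentially.
          - w k * K $$ (i, j) + (if i = j then 1 + (a k - of_real (\<sigma> * \<tau> k)) * w k else 0) = A k $$ (i, j)"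
        using filterlim_at_top_dense[THEN iffD1, OF \<tau>, rule_format, of 0]
      proof eventually_elim
        case (elim k)
        then have "complex_of_real (\<sigma> * \<tau> k) \<noteq> 0" using \<sigma> by auto
        then have w2: "2 * (complex_of_real (\<sigma> * \<tau> k) * w k) = 1" by (simp add: w_def)
        have s: "s k i = - w k" using False by (simp add: s_def w_def)
        have "complex_of_real (\<tau> k * D i) = - of_real (\<sigma> * \<tau> k)" using Di by simp
        then have "A k $$ (i, j) = - w k * (K $$ (i, j) + (if i = j then - of_real (\<sigma> * \<tau> k) - a k else 0))"
          using ij by (simp only: Aij Cij s)
        also have "\<dots> = - w k * K $$ (i, j) + (if i = j then (2 * (of_real (\<sigma> * \<tau> k) * w k))
            + (a k - of_real (\<sigma> * \<tau> k)) * w k else 0)"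
          by (simp add: algebra_simps)
        finally show ?case unfolding w2 by simp
      qed
      show ?thesis using Lim_transform_eventually[OF f1 f3] unfolding f2 .
    qed
  qed simp
  ultimately show ?thesis by (simp add: LIMSEQ_const_iff)
qed

text \<open>Gershgorin's argument: compare both sides of the eigenvector equation in the row where
  the eigenvector is largest. The bound is crude but independent of \<open>d\<close>, which may then
  grow without limit.\<close>

lemma eigenvalue_near_diagonal:
  fixes K :: "complex mat"
  assumes K: "K \<in> carrier_mat m m" and ev: "eigenvalue (K + mat_diag m d) a"
  shows "\<exists>i<m. cmod (a - d i) \<le> (\<Sum>i<m. \<Sum>j<m. cmod (K $$ (i, j)))"
proof -
  obtain v where v: "v \<in> carrier_vec m" "v \<noteq> 0\<^sub>v m" "(K + mat_diag m d) *\<^sub>v v = a \<cdot>\<^sub>v v"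
    using ev K by (auto simp: eigenvalue_def eigenvector_def mat_diag_def)
  have "\<exists>i<m. v $ i \<noteq> 0" using v(1,2) by (metis carrier_vecD eq_vecI index_zero_vec)
  then obtain i0 where i0: "i0 < m" "v $ i0 \<noteq> 0" by blast
  let ?V = "(\<lambda>j. cmod (v $ j)) ` {..<m}"
  have "Max ?V \<in> ?V" using i0 by (intro Max_in) auto
  then obtain i where i: "i < m" "Max ?V = cmod (v $ i)" by auto
  have max: "cmod (v $ j) \<le> cmod (v $ i)" if "j < m" for j
    using that unfolding i(2)[symmetric] by (intro Max_ge) auto
  have vi: "cmod (v $ i) > 0" using max[OF i0(1)] i0(2) by (smt (verit) zero_less_norm_iff)
  have "((K + mat_diag m d) *\<^sub>v v) $ i = (\<Sum>j<m. K $$ (i, j) * v $ j) + d i * v $ i"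
  proof -
    have "((K + mat_diag m d) *\<^sub>v v) $ i = (\<Sum>j<m. (K $$ (i, j) + (if i = j then d j else 0)) * v $ j)"
      using K v(1) i by (simp add: scalar_prod_def mat_diag_def atLeast0LessThan)
    also have "\<dots> = (\<Sum>j<m. K $$ (i, j) * v $ j) + (\<Sum>j<m. if i = j then d j * v $ j else 0)"
      by (simp add: ring_distribs sum.distrib if_distrib[of "\<lambda>x. x * _"] cong: if_cong)
    finally show ?thesis using i by simp
  qed
  then have "(a - d i) * v $ i = (\<Sum>j<m. K $$ (i, j) * v $ j)"
    using v i by (simp add: algebra_simps)
  then have "cmod (a - d i) * cmod (v $ i) \<le> (\<Sum>j<m. cmod (K $$ (i, j) * v $ j))"
    by (metis norm_mult norm_sum)
  also have "\<dots> \<le> (\<Sum>j<m. cmod (K $$ (i, j)) * cmod (v $ i))"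
    using max by (intro sum_mono) (simp add: norm_mult mult_left_mono)
  also have "\<dots> = (\<Sum>j<m. cmod (K $$ (i, j))) * cmod (v $ i)" by (simp add: sum_distrib_right)
  finally have "cmod (a - d i) \<le> (\<Sum>j<m. cmod (K $$ (i, j)))" using vi by simp
  also have "\<dots> \<le> (\<Sum>i<m. \<Sum>j<m. cmod (K $$ (i, j)))"
    using i by (intro member_le_sum) (auto intro: sum_nonneg)
  finally show ?thesis using i by blast
qed

text \<open>The two eigenvalues differ by the fixed \<open>g\<close>, so they follow the same one of
  the levels \<tau> and - \<tau>. Relative to this level the first one is bounded; along a
  subsequence it converges to some \<open>x\<close>, and the second then tends to
  \<open>x - g\<close>.\<close>

lemma eigenvalue_gap_limit:
  fixes K :: "complex mat" and D :: "nat \<Rightarrow> real"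
  assumes K: "K \<in> carrier_mat m m" and D: "\<And>i. D i = 1 \<or> D i = - 1"
    and gap: "\<exists>\<^sub>F \<tau> in at_top. \<exists>a. eigenvalue (K + mat_diag m (\<lambda>i. of_real (\<tau> * D i))) a \<and>
      eigenvalue (K + mat_diag m (\<lambda>i. of_real (\<tau> * D i))) (a - g)"
  obtains \<sigma> x where "\<sigma> = 1 \<or> \<sigma> = - 1"
    "\<And>y. y = x \<or> y = x - g \<Longrightarrow> det (mat m m (\<lambda>(i, j). if D i = \<sigma> then K $$ (i, j) - (if i = j then y else 0)
      else if i = j then 1 else 0)) = 0"
proof -
  define R where "R = (\<Sum>i<m. \<Sum>j<m. cmod (K $$ (i, j)))"
  define Q where "Q = (\<lambda>\<sigma> \<tau>. \<exists>a. eigenvalue (K + mat_diag m (\<lambda>i. of_real (\<tau> * D i))) a \<and>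
      eigenvalue (K + mat_diag m (\<lambda>i. of_real (\<tau> * D i))) (a - g) \<and> cmod (a - of_real (\<sigma> * \<tau>)) \<le> R)"
  have near: "cmod (a - of_real \<tau>) \<le> R \<or> cmod (a - of_real (- \<tau>)) \<le> R"
    if ev: "eigenvalue (K + mat_diag m (\<lambda>i. of_real (\<tau> * D i))) a" for a \<tau>
  proof -
    obtain i where i: "cmod (a - of_real (\<tau> * D i)) \<le> R"
      using eigenvalue_near_diagonal[OF K ev] unfolding R_def by blast
    show ?thesis
    proof (cases "D i = 1")
      case True
      then show ?thesis using i by simp
    next
      case False
      then have "D i = - 1" using D[of i] by simp
      then show ?thesis using i by simp
    qed
  qed
  have "\<exists>\<^sub>F \<tau> in at_top. Q 1 \<tau> \<or> Q (- 1) \<tau>"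
    using gap
  proof (rule frequently_mono[rotated], intro allI impI)
    fix \<tau> assume "\<exists>a. eigenvalue (K + mat_diag m (\<lambda>i. of_real (\<tau> * D i))) a \<and>
      eigenvalue (K + mat_diag m (\<lambda>i. of_real (\<tau> * D i))) (a - g)"
    then obtain a where a: "eigenvalue (K + mat_diag m (\<lambda>i. of_real (\<tau> * D i))) a"
      "eigenvalue (K + mat_diag m (\<lambda>i. of_real (\<tau> * D i))) (a - g)" by blast
    show "Q 1 \<tau> \<or> Q (- 1) \<tau>"
      using near[OF a(1)]
    proof
      assume "cmod (a - of_real \<tau>) \<le> R"
      then have "Q 1 \<tau>" unfolding Q_def by (intro exI[of _ a] conjI a) simp
      then show ?thesis ..
    next
      assume "cmod (a - of_real (- \<tau>)) \<le> R"
      then have "Q (- 1) \<tau>" unfolding Q_def by (intro exI[of _ a] conjI a) simp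
      then show ?thesis ..
    qed
  qed
  \<comment> \<open>At least one of the two levels is followed for arbitrarily large \<tau>.\<close>
  then obtain \<sigma> where \<sigma>: "\<sigma> = 1 \<or> \<sigma> = - 1" and freq: "\<exists>\<^sub>F \<tau> in at_top. Q \<sigma> \<tau>"
    unfolding frequently_disj_iff by blast
  have "\<exists>\<tau>. real k \<le> \<tau> \<and> Q \<sigma> \<tau>" for k
    using freq unfolding frequently_def eventually_at_top_linorder by blast
  then obtain \<tau> where \<tau>: "\<And>k. real k \<le> \<tau> k" "\<And>k. Q \<sigma> (\<tau> k)" by metis
  have "\<forall>k. \<exists>a. eigenvalue (K + mat_diag m (\<lambda>i. of_real (\<tau> k * D i))) a \<and>
      eigenvalue (K + mat_diag m (\<lambda>i. of_real (\<tau> k * D i))) (a - g) \<and> cmod (a - of_real (\<sigma> * \<tau> k)) \<le> R"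
    using \<tau>(2) unfolding Q_def by blast
  from choice[OF this] obtain a where a: "\<And>k. eigenvalue (K + mat_diag m (\<lambda>i. of_real (\<tau> k * D i))) (a k)"
      "\<And>k. eigenvalue (K + mat_diag m (\<lambda>i. of_real (\<tau> k * D i))) (a k - g)"
      "\<And>k. cmod (a k - of_real (\<sigma> * \<tau> k)) \<le> R"
    by blast
  have "bounded (range (\<lambda>k. a k - of_real (\<sigma> * \<tau> k)))"
    unfolding bounded_iff using a(3) by blast
  then obtain x r where r: "strict_mono r" and x: "((\<lambda>k. a k - of_real (\<sigma> * \<tau> k)) \<circ> r) \<longlonglongrightarrow> x"
    using bounded_imp_convergent_subsequence by blast
  have "filterlim \<tau> at_top sequentially"
    by (rule filterlim_at_top_mono[OF filterlim_real_sequentially]) (use \<tau>(1) in simp)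
  then have \<tau>r: "filterlim (\<lambda>k. \<tau> (r k)) at_top sequentially"
    using filterlim_subseq[OF r] by (rule filterlim_compose)
  have D': "D i = \<sigma> \<or> D i = - \<sigma>" for i using D[of i] \<sigma> by auto
  have x1: "(\<lambda>k. a (r k) - of_real (\<sigma> * \<tau> (r k))) \<longlonglongrightarrow> x" using x by (simp add: o_def)
  have x2: "(\<lambda>k. a (r k) - g - of_real (\<sigma> * \<tau> (r k))) \<longlonglongrightarrow> x - g"
    using tendsto_diff[OF x1 tendsto_const[of g]] by (simp add: algebra_simps)
  show ?thesis
  proof (rule that[OF \<sigma>])
    fix y assume "y = x \<or> y = x - g"
    then show "det (mat m m (\<lambda>(i, j). if D i = \<sigma> then K $$ (i, j) - (if i = j then y else 0)
      else if i = j then 1 else 0)) = 0"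
      using eigenvalue_limit[OF K \<sigma> D' \<tau>r a(1) x1] eigenvalue_limit[OF K \<sigma> D' \<tau>r a(2) x2] by blast
  qed
qed

text \<open>The limit matrix is block triangular with one identity block, so the off-diagonal blocks
  drop out of its determinant and an eigenvalue condition on \<open>M1\<close> or \<open>M2\<close>
  alone is left.\<close>

lemma block_gap_limit:
  fixes M1 M2 V W :: "complex mat"
  assumes M: "M1 \<in> carrier_mat n n" "M2 \<in> carrier_mat n n" "V \<in> carrier_mat n n" "W \<in> carrier_mat n n"
    and gap: "\<exists>\<^sub>F \<tau> in at_top. \<exists>a.
      eigenvalue (four_block_mat (M1 + of_real \<tau> \<cdot>\<^sub>m 1\<^sub>m n) V W (M2 + of_real (- \<tau>) \<cdot>\<^sub>m 1\<^sub>m n)) a \<and>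
      eigenvalue (four_block_mat (M1 + of_real \<tau> \<cdot>\<^sub>m 1\<^sub>m n) V W (M2 + of_real (- \<tau>) \<cdot>\<^sub>m 1\<^sub>m n)) (a - g)"
  shows "\<exists>M x. (M = M1 \<or> M = M2) \<and> eigenvalue M x \<and> eigenvalue M (x - g)"
proof -
  define K where "K = four_block_mat M1 V W M2"
  define D :: "nat \<Rightarrow> real" where "D = (\<lambda>i. if i < n then 1 else - 1)"
  have K: "K \<in> carrier_mat (n + n) (n + n)" unfolding K_def using M by auto
  have eq: "four_block_mat (M1 + of_real \<tau> \<cdot>\<^sub>m 1\<^sub>m n) V W (M2 + of_real (- \<tau>) \<cdot>\<^sub>m 1\<^sub>m n)
      = K + mat_diag (n + n) (\<lambda>i. of_real (\<tau> * D i))" for \<tau>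
    by (rule eq_matI) (use M in \<open>auto simp: K_def D_def mat_diag_def\<close>)
  have D: "D i = 1 \<or> D i = - 1" for i by (simp add: D_def)
  obtain \<sigma> x where \<sigma>: "\<sigma> = 1 \<or> \<sigma> = - 1" and
    L: "\<And>y. y = x \<or> y = x - g \<Longrightarrow> det (mat (n + n) (n + n) (\<lambda>(i, j). if D i = \<sigma>
      then K $$ (i, j) - (if i = j then y else 0) else if i = j then 1 else 0)) = 0"
    using eigenvalue_gap_limit[OF K D gap[unfolded eq]] by blast
  have ev: "eigenvalue M1 y" if "y = x \<or> y = x - g" "\<sigma> = 1" for y
  proof -
    have "mat (n + n) (n + n) (\<lambda>(i, j). if D i = \<sigma>
      then K $$ (i, j) - (if i = j then y else 0) else if i = j then 1 else 0)
      = four_block_mat (char_matrix M1 y) V (0\<^sub>m n n) (1\<^sub>m n)"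
      by (rule eq_matI) (use M that(2) in \<open>auto simp: K_def D_def char_matrix_def\<close>)
    then have "det (char_matrix M1 y) = 0"
      using L[OF that(1)] M det_four_block_mat_lower_left_zero[of "char_matrix M1 y" n V n "0\<^sub>m n n" "1\<^sub>m n"]
      by simp
    then show ?thesis using eigenvalue_det[OF M(1)] by blast
  qed
  have ev': "eigenvalue M2 y" if "y = x \<or> y = x - g" "\<sigma> = - 1" for y
  proof -
    have "mat (n + n) (n + n) (\<lambda>(i, j). if D i = \<sigma>
      then K $$ (i, j) - (if i = j then y else 0) else if i = j then 1 else 0)
      = four_block_mat (1\<^sub>m n) (0\<^sub>m n n) W (char_matrix M2 y)"
      by (rule eq_matI) (use M that(2) in \<open>auto simp: K_def D_def char_matrix_def\<close>)
    then have "det (char_matrix M2 y) = 0"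
      using L[OF that(1)] M det_four_block_mat_upper_right_zero[of "1\<^sub>m n" n "0\<^sub>m n n" n W "char_matrix M2 y"]
      by simp
    then show ?thesis using eigenvalue_det[OF M(2)] by blast
  qed
  show ?thesis
    using \<sigma>
  proof
    assume "\<sigma> = 1"
    then have "eigenvalue M1 x" "eigenvalue M1 (x - g)" by (simp_all add: ev)
    then show ?thesis by blast
  next
    assume "\<sigma> = - 1"
    then have "eigenvalue M2 x" "eigenvalue M2 (x - g)" by (simp_all add: ev')
    then show ?thesis by blast
  qed
qed

section \<open>Gaps of shifted, scaled and block diagonal matrices\<close>

definition simple_spectrum :: "complex mat \<Rightarrow> bool" where
  "simple_spectrum A \<longleftrightarrow> (\<exists>E. eigenvalue_list A E \<and> distinct E)"

text \<open>The zero difference is left out since it occurs in every nonempty spectrum;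
  multiplicities are recorded by \<open>simple_spectrum\<close> instead.\<close>

definition gaps :: "complex mat \<Rightarrow> complex set" where
  "gaps A = {g. g \<noteq> 0 \<and> (\<exists>x. eigenvalue A x \<and> eigenvalue A (x - g))}"

lemma finite_gaps:
  assumes "A \<in> carrier_mat n n"
  shows "finite (gaps A)"
proof -
  obtain E where E: "eigenvalue_list A E" by (rule eigenvalue_list_exists[OF assms])
  have "gaps A \<subseteq> (\<lambda>(x, y). x - y) ` (set E \<times> set E)"
  proof
    fix g assume "g \<in> gaps A"
    then obtain x where "x \<in> set E" "x - g \<in> set E"
      unfolding set_eigenvalue_list[OF assms E] by (auto simp: gaps_def)
    then have "(x, x - g) \<in> set E \<times> set E" by simp
    then have "(\<lambda>(x, y). x - y) (x, x - g) \<in> (\<lambda>(x, y). x - y) ` (set E \<times> set E)"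
      by (rule imageI)
    then show "g \<in> (\<lambda>(x, y). x - y) ` (set E \<times> set E)" by simp
  qed
  then show ?thesis by (rule finite_subset) simp
qed

text \<open>As both spectra are nonempty, comparing a difference with a zero difference
  \<open>j = k\<close> or \<open>p = q\<close> of the other matrix tests simplicity; a nonzero
  coincidence is a common element of the two sets of gaps.\<close>

lemma gap_independent_iff:
  assumes A: "A \<in> carrier_mat n n" and B: "B \<in> carrier_mat m m" and pos: "0 < n" "0 < m"
  shows "gap_independent A B \<longleftrightarrow> simple_spectrum A \<and> simple_spectrum B \<and> gaps A \<inter> gaps B = {}"
proof
  assume "gap_independent A B"
  then obtain E F where E: "eigenvalue_list A E" and F: "eigenvalue_list B F"
    and ind: "\<And>j k p q. j < length E \<Longrightarrow> k < length E \<Longrightarrow> p < length F \<Longrightarrow> q < length F \<Longrightarrow>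
      E ! j - E ! k = F ! p - F ! q \<Longrightarrow> j = k \<and> p = q"
    unfolding gap_independent_def by blast
  have len: "0 < length E" "0 < length F"
    using length_eigenvalue_list[OF A E] length_eigenvalue_list[OF B F] pos by simp_all
  have "distinct E" unfolding distinct_conv_nth using ind[OF _ _ len(2) len(2)] by auto
  moreover have "distinct F" unfolding distinct_conv_nth using ind[OF len(1) len(1)] by auto
  moreover have "gaps A \<inter> gaps B = {}"
  proof (rule ccontr)
    assume "gaps A \<inter> gaps B \<noteq> {}"
    then obtain g x y where g: "g \<noteq> 0" "x \<in> set E" "x - g \<in> set E" "y \<in> set F" "y - g \<in> set F"
      unfolding set_eigenvalue_list[OF A E] set_eigenvalue_list[OF B F] gaps_def by blast
    then obtain j k p q where jk: "j < length E" "k < length E" "p < length F" "q < length F"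
      "E ! j = x" "E ! k = x - g" "F ! p = y" "F ! q = y - g"
      by (auto simp: in_set_conv_nth)
    then have "j = k" using ind[of j k p q] by simp
    then show False using jk g(1) by simp
  qed
  ultimately show "simple_spectrum A \<and> simple_spectrum B \<and> gaps A \<inter> gaps B = {}"
    unfolding simple_spectrum_def using E F by blast
next
  assume *: "simple_spectrum A \<and> simple_spectrum B \<and> gaps A \<inter> gaps B = {}"
  then obtain E F where E: "eigenvalue_list A E" "distinct E" and F: "eigenvalue_list B F" "distinct F"
    unfolding simple_spectrum_def by blast
  have "j = k \<and> p = q" if jk: "j < length E" "k < length E" "p < length F" "q < length F"
    and eq: "E ! j - E ! k = F ! p - F ! q" for j k p q
  proof -
    define g where "g = E ! j - E ! k"
    have "E ! j \<in> set E" "E ! j - g \<in> set E" using jk by (simp_all add: g_def)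
    moreover have "F ! p \<in> set F" "F ! p - g \<in> set F" using jk by (simp_all add: g_def eq)
    ultimately have "g \<noteq> 0 \<Longrightarrow> g \<in> gaps A \<inter> gaps B"
      unfolding set_eigenvalue_list[OF A E(1)] set_eigenvalue_list[OF B F(1)] gaps_def by blast
    then have "g = 0" using * by blast
    then have "E ! j = E ! k" "F ! p = F ! q" using eq by (simp_all add: g_def)
    then show ?thesis using jk E(2) F(2) by (simp add: nth_eq_iff_index_eq)
  qed
  then show "gap_independent A B"
    unfolding gap_independent_def using E F by blast
qed

text \<open>A one-point spectrum has no gaps, so only the simplicity of \<open>A\<close> remains. In
  this form the polynomial criterion for gap independence also covers simple spectra.\<close>

lemma gap_independent_zero_iff:
  assumes A: "A \<in> carrier_mat n n" "0 < n"
  shows "gap_independent A (0\<^sub>m 1 1) \<longleftrightarrow> simple_spectrum A"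
proof -
  have Z: "(0\<^sub>m 1 1 :: complex mat) \<in> carrier_mat 1 1" by simp
  obtain E where E: "eigenvalue_list (0\<^sub>m 1 1) E" "length E = 1"
    by (rule eigenvalue_list_exists[OF Z])
  then obtain e where e: "E = [e]" by (auto simp: length_Suc_conv)
  then have "simple_spectrum (0\<^sub>m 1 1)" unfolding simple_spectrum_def using E by auto
  moreover have "gaps (0\<^sub>m 1 1) = {}"
  proof -
    have "eigenvalue (0\<^sub>m 1 1) x \<longleftrightarrow> x = e" for x
      using set_eigenvalue_list[OF Z E(1)] unfolding e by auto
    then show ?thesis unfolding gaps_def by simp
  qed
  ultimately show ?thesis using gap_independent_iff[OF A(1) Z A(2)] by simp
qed

text \<open>One good parameter makes the deciding polynomial nonzero, so it has finitely many zeros.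
  In this way several generic conditions can be met at once along a one-parameter family.\<close>

lemma finite_not_gap_independent:
  fixes A B :: "real \<Rightarrow> complex mat"
  assumes A: "\<And>t. A t \<in> carrier_mat n n" "\<And>i j. i < n \<Longrightarrow> j < n \<Longrightarrow> (\<lambda>t. A t $$ (i, j)) \<in> real_polynomials"
    and B: "\<And>t. B t \<in> carrier_mat m m" "\<And>i j. i < m \<Longrightarrow> j < m \<Longrightarrow> (\<lambda>t. B t $$ (i, j)) \<in> real_polynomials"
    and s: "gap_independent (A s) (B s)"
  shows "finite {t. \<not> gap_independent (A t) (B t)}"
proof -
  obtain D where D: "D \<in> real_polynomials" "\<And>t. D t \<noteq> 0 \<longleftrightarrow> gap_independent (A t) (B t)"
    using real_polynomials.gap_independent_polynomial[OF A B] by blast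
  have "finite {t. D t = 0}" by (rule finite_zeros_real_polynomials[OF D(1)]) (use s D in blast)
  moreover have "{t. \<not> gap_independent (A t) (B t)} = {t. D t = 0}" using D(2) by blast
  ultimately show ?thesis by simp
qed

lemma finite_not_simple_spectrum:
  fixes A :: "real \<Rightarrow> complex mat"
  assumes A: "\<And>t. A t \<in> carrier_mat n n" "\<And>i j. i < n \<Longrightarrow> j < n \<Longrightarrow> (\<lambda>t. A t $$ (i, j)) \<in> real_polynomials"
    and n: "0 < n" and s: "simple_spectrum (A s)"
  shows "finite {t. \<not> simple_spectrum (A t)}"
proof -
  have "finite {t. \<not> gap_independent (A t) (0\<^sub>m 1 1)}"
    by (rule finite_not_gap_independent[OF A, where m = 1 and B = "\<lambda>_. 0\<^sub>m 1 1" and s = s])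
      (use s in \<open>auto simp: gap_independent_zero_iff[OF A(1) n] real_polynomials.const simp del: One_nat_def\<close>)
  then show ?thesis by (simp only: gap_independent_zero_iff[OF A(1) n])
qed

lemma finite_not_nondegenerate_gaps:
  fixes A :: "real \<Rightarrow> complex mat"
  assumes A: "\<And>t. A t \<in> carrier_mat n n" "\<And>i j. i < n \<Longrightarrow> j < n \<Longrightarrow> (\<lambda>t. A t $$ (i, j)) \<in> real_polynomials"
    and s: "nondegenerate_gaps (A s)"
  shows "finite {t. \<not> nondegenerate_gaps (A t)}"
proof -
  obtain D where D: "D \<in> real_polynomials" "\<And>t. D t \<noteq> 0 \<longleftrightarrow> nondegenerate_gaps (A t)"
    using real_polynomials.nondegenerate_gaps_polynomial[OF A] by blast
  have "finite {t. D t = 0}" by (rule finite_zeros_real_polynomials[OF D(1)]) (use s D in blast)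
  moreover have "{t. \<not> nondegenerate_gaps (A t)} = {t. D t = 0}" using D(2) by blast
  ultimately show ?thesis by simp
qed

lemma nondegenerate_gapsI:
  assumes E: "eigenvalue_list A E" "distinct E"
    and gap: "\<And>w x y z. w \<in> set E \<Longrightarrow> x \<in> set E \<Longrightarrow> y \<in> set E \<Longrightarrow> z \<in> set E \<Longrightarrow> w \<noteq> x \<Longrightarrow>
      w - x = y - z \<Longrightarrow> w = y \<and> x = z"
  shows "nondegenerate_gaps A"
  unfolding nondegenerate_gaps_def
proof (intro exI[of _ E] conjI E allI impI; elim conjE)
  fix j k p q assume jk: "j < length E" "k < length E" "p < length E" "q < length E" "j \<noteq> k"
    and eq: "E ! j - E ! k = E ! p - E ! q"
  have "E ! j = E ! p \<and> E ! k = E ! q"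
    by (rule gap) (use jk E(2) eq in \<open>auto simp: nth_eq_iff_index_eq\<close>)
  then show "j = p" "k = q" using jk E(2) by (simp_all add: nth_eq_iff_index_eq)
qed

lemma nondegenerate_gapsE:
  assumes "nondegenerate_gaps A"
  obtains E where "eigenvalue_list A E" "distinct E"
    "\<And>w x y z. w \<in> set E \<Longrightarrow> x \<in> set E \<Longrightarrow> y \<in> set E \<Longrightarrow> z \<in> set E \<Longrightarrow> w \<noteq> x \<Longrightarrow>
      w - x = y - z \<Longrightarrow> w = y \<and> x = z"
proof -
  obtain E where E: "eigenvalue_list A E" and gap: "\<And>j k p q. j < length E \<Longrightarrow> k < length E \<Longrightarrow>
      p < length E \<Longrightarrow> q < length E \<Longrightarrow> j \<noteq> k \<Longrightarrow> E ! j - E ! k = E ! p - E ! q \<Longrightarrow> j = p \<and> k = q"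
    using assms unfolding nondegenerate_gaps_def by blast
  have "distinct E"
    unfolding distinct_conv_nth
  proof (intro allI impI notI)
    fix i j assume ij: "i < length E" "j < length E" "i \<noteq> j" "E ! i = E ! j"
    \<comment> \<open>A repeated eigenvalue would give the pair \<open>i, j\<close> the same zero
      difference as \<open>i, i\<close>.\<close>
    then show False using gap[of i j i i] by simp
  qed
  moreover have "w = y \<and> x = z" if mem: "w \<in> set E" "x \<in> set E" "y \<in> set E" "z \<in> set E"
    and ne: "w \<noteq> x" and eq: "w - x = y - z" for w x y z
  proof -
    obtain j k p q where "j < length E" "k < length E" "p < length E" "q < length E"
      "E ! j = w" "E ! k = x" "E ! p = y" "E ! q = z"
      using mem by (auto simp: in_set_conv_nth)
    moreover from this have "j = p \<and> k = q" using gap[of j k p q] ne eq by auto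
    ultimately show ?thesis by auto
  qed
  ultimately show ?thesis using that E by blast
qed

section \<open>Spectra under shifts, scaling and direct sums\<close>

lemma poly_prod_linear: "poly (\<Prod>e\<leftarrow>E. [:- e, 1:]) y = (\<Prod>e\<leftarrow>E. y - e)" for y :: complex
  by (induction E) (auto simp: algebra_simps)

text \<open>A complex polynomial is determined by its values, so it suffices to evaluate the
  characteristic polynomial; shifts, multiples and direct sums then become identities between
  determinants.\<close>

lemma eigenvalue_listI:
  assumes "A \<in> carrier_mat n n" "\<And>y. det (- char_matrix A y) = (\<Prod>e\<leftarrow>E. y - e)"
  shows "eigenvalue_list A E"
proof -
  have "poly (char_poly A) = poly (\<Prod>e\<leftarrow>E. [:- e, 1:])"
    using char_poly_matrix[OF assms(1)] assms(2) by (auto simp: poly_prod_linear)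
  then show ?thesis unfolding eigenvalue_list_def by (simp add: poly_eq_poly_eq_iff)
qed

lemma eigenvalue_listD:
  assumes "A \<in> carrier_mat n n" "eigenvalue_list A E"
  shows "det (- char_matrix A y) = (\<Prod>e\<leftarrow>E. y - e)"
  using char_poly_matrix[OF assms(1), of y] assms(2) by (simp add: eigenvalue_list_def poly_prod_linear)

lemma eigenvalue_list_shift:
  assumes A: "A \<in> carrier_mat n n" and E: "eigenvalue_list A E"
  shows "eigenvalue_list (A + c \<cdot>\<^sub>m 1\<^sub>m n) (map (\<lambda>e. e + c) E)"
proof (rule eigenvalue_listI)
  show "A + c \<cdot>\<^sub>m 1\<^sub>m n \<in> carrier_mat n n" using A by simp
  fix y
  have "char_matrix (A + c \<cdot>\<^sub>m 1\<^sub>m n) y = char_matrix A (y - c)"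
    by (rule eq_matI) (use A in \<open>auto simp: char_matrix_def\<close>)
  then show "det (- char_matrix (A + c \<cdot>\<^sub>m 1\<^sub>m n) y) = (\<Prod>e\<leftarrow>map (\<lambda>e. e + c) E. y - e)"
    using eigenvalue_listD[OF A E, of "y - c"] by (simp add: o_def algebra_simps)
qed

lemma eigenvalue_list_smult:
  assumes A: "A \<in> carrier_mat n n" and E: "eigenvalue_list A E" and c: "c \<noteq> 0"
  shows "eigenvalue_list (c \<cdot>\<^sub>m A) (map ((*) c) E)"
proof (rule eigenvalue_listI)
  show "c \<cdot>\<^sub>m A \<in> carrier_mat n n" using A by simp
  fix y
  have "- char_matrix (c \<cdot>\<^sub>m A) y = c \<cdot>\<^sub>m (- char_matrix A (y / c))"
    by (rule eq_matI) (use A c in \<open>auto simp: char_matrix_def field_simps\<close>)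
  then have "det (- char_matrix (c \<cdot>\<^sub>m A) y) = c ^ length E * (\<Prod>e\<leftarrow>E. y / c - e)"
    using eigenvalue_listD[OF A E, of "y / c"] length_eigenvalue_list[OF A E] A by (simp add: char_matrix_def)
  also have "\<dots> = (\<Prod>e\<leftarrow>E. y - c * e)"
    using c by (induction E) (auto simp: field_simps)
  finally show "det (- char_matrix (c \<cdot>\<^sub>m A) y) = (\<Prod>e\<leftarrow>map ((*) c) E. y - e)" by (simp add: o_def)
qed

lemma eigenvalue_list_block:
  assumes A: "A \<in> carrier_mat n n" and B: "B \<in> carrier_mat n n"
    and E: "eigenvalue_list A E" and F: "eigenvalue_list B F"
  shows "eigenvalue_list (four_block_mat A (0\<^sub>m n n) (0\<^sub>m n n) B) (E @ F)"
proof (rule eigenvalue_listI)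
  show "four_block_mat A (0\<^sub>m n n) (0\<^sub>m n n) B \<in> carrier_mat (n + n) (n + n)"
    using A B by simp
  fix y
  have "- char_matrix (four_block_mat A (0\<^sub>m n n) (0\<^sub>m n n) B) y =
    four_block_mat (- char_matrix A y) (0\<^sub>m n n) (0\<^sub>m n n) (- char_matrix B y)"
    by (rule eq_matI) (use A B in \<open>auto simp: char_matrix_def\<close>)
  moreover have "det \<dots> = det (- char_matrix A y) * det (- char_matrix B y)"
    using A B by (intro det_four_block_mat_lower_left_zero[of _ n _ n]) auto
  ultimately show "det (- char_matrix (four_block_mat A (0\<^sub>m n n) (0\<^sub>m n n) B) y) = (\<Prod>e\<leftarrow>E @ F. y - e)"
    using eigenvalue_listD[OF A E] eigenvalue_listD[OF B F] by simp
qed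

lemma nondegenerate_gaps_smult:
  assumes A: "A \<in> carrier_mat n n" and c: "c \<noteq> 0" and nd: "nondegenerate_gaps A"
  shows "nondegenerate_gaps (c \<cdot>\<^sub>m A)"
proof -
  obtain E where E: "eigenvalue_list A E" "distinct E" and gap: "\<And>w x y z. w \<in> set E \<Longrightarrow> x \<in> set E \<Longrightarrow>
      y \<in> set E \<Longrightarrow> z \<in> set E \<Longrightarrow> w \<noteq> x \<Longrightarrow> w - x = y - z \<Longrightarrow> w = y \<and> x = z"
    using nondegenerate_gapsE[OF nd] by blast
  show ?thesis
  proof (rule nondegenerate_gapsI[OF eigenvalue_list_smult[OF A E(1) c]])
    show "distinct (map ((*) c) E)" using E(2) c by (simp add: distinct_map inj_on_def)
    fix w x y z assume "w \<in> set (map ((*) c) E)" "x \<in> set (map ((*) c) E)"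
      "y \<in> set (map ((*) c) E)" "z \<in> set (map ((*) c) E)" and *: "w \<noteq> x" "w - x = y - z"
    then obtain w' x' y' z' where m: "w' \<in> set E" "x' \<in> set E" "y' \<in> set E" "z' \<in> set E"
      "w = c * w'" "x = c * x'" "y = c * y'" "z = c * z'" by auto
    have "c * (w' - x') = c * (y' - z')" using *(2) m by (simp add: right_diff_distrib)
    then have "w' - x' = y' - z'" using c by simp
    then show "w = y \<and> x = z" using gap[OF m(1-4)] * m by auto
  qed
qed

lemma distinct_shifted_union:
  fixes E F :: "complex list" and b R :: real
  assumes "distinct E" "distinct F" and R: "\<And>x. x \<in> set E \<union> set F \<Longrightarrow> cmod x \<le> R" and b: "R < b" "0 < b"
  shows "distinct (map (\<lambda>e. e + of_real b) E @ map (\<lambda>e. e + of_real (- b)) F)"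
proof -
  have "x + of_real b \<noteq> y + of_real (- b)" if "x \<in> set E" "y \<in> set F" for x y
  proof
    assume "x + of_real b = y + of_real (- b)"
    then have "y - x = of_real (2 * b)" by (simp add: algebra_simps)
    then have "2 * b \<le> cmod (y - x)" using b by simp
    also have "\<dots> \<le> R + R" by (rule order_trans[OF norm_triangle_ineq4 add_mono]) (use R that in auto)
    finally show False using b by simp
  qed
  then show ?thesis using assms(1,2) by (auto simp: distinct_map inj_on_def)
qed

text \<open>Shifting two spectra far apart separates the gap equations by how many of the four energies
  come from each of them.\<close>

lemma nondegenerate_gaps_block:
  assumes A: "A \<in> carrier_mat n n" and B: "B \<in> carrier_mat n n" and n: "0 < n"
    and nA: "nondegenerate_gaps A" and nB: "nondegenerate_gaps B" and ind: "gap_independent A B"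
  obtains b :: real where "nondegenerate_gaps (four_block_mat (A + of_real b \<cdot>\<^sub>m 1\<^sub>m n) (0\<^sub>m n n) (0\<^sub>m n n)
    (B + of_real (- b) \<cdot>\<^sub>m 1\<^sub>m n))"
proof -
  obtain E where E: "eigenvalue_list A E" "distinct E" and gE: "\<And>w x y z. w \<in> set E \<Longrightarrow> x \<in> set E \<Longrightarrow>
      y \<in> set E \<Longrightarrow> z \<in> set E \<Longrightarrow> w \<noteq> x \<Longrightarrow> w - x = y - z \<Longrightarrow> w = y \<and> x = z"
    using nondegenerate_gapsE[OF nA] by blast
  obtain F where F: "eigenvalue_list B F" "distinct F" and gF: "\<And>w x y z. w \<in> set F \<Longrightarrow> x \<in> set F \<Longrightarrow>
      y \<in> set F \<Longrightarrow> z \<in> set F \<Longrightarrow> w \<noteq> x \<Longrightarrow> w - x = y - z \<Longrightarrow> w = y \<and> x = z"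
    using nondegenerate_gapsE[OF nB] by blast
  have EF: "w = x \<and> y = z" if m: "w \<in> set E" "x \<in> set E" "y \<in> set F" "z \<in> set F" and eq: "w - x = y - z" for w x y z
  proof -
    have "w - x \<notin> gaps A \<or> w - x \<notin> gaps B"
      using ind unfolding gap_independent_iff[OF A B n n] by blast
    moreover have "w - x \<in> gaps A" if "w - x \<noteq> 0"
    proof -
      have "w - (w - x) = x" by simp
      then show ?thesis using m that unfolding set_eigenvalue_list[OF A E(1)] gaps_def by auto
    qed
    moreover have "w - x \<in> gaps B" if "w - x \<noteq> 0"
    proof -
      have "y - (w - x) = z" using eq by simp
      then have "eigenvalue B y \<and> eigenvalue B (y - (w - x))"
        using m unfolding set_eigenvalue_list[OF B F(1)] by simp
      then show ?thesis using that unfolding gaps_def by blast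
    qed
    ultimately have "w - x = 0" by blast
    then show ?thesis using eq by simp
  qed
  define R where "R = (\<Sum>x\<in>set E \<union> set F. cmod x)"
  have R: "cmod x \<le> R" if "x \<in> set E \<union> set F" for x
    unfolding R_def using that by (intro member_le_sum) auto
  have R0: "0 \<le> R" unfolding R_def by (rule sum_nonneg) simp
  \<comment> \<open>With \<open>4 * R < 2 * b\<close>, the four unshifted energies cannot compensate
    a net shift of \<open>2 * b\<close> or more.\<close>
  define b where "b = 2 * R + 1"
  have b: "R < b" "0 < b" "4 * R < 2 * b" using R0 by (simp_all add: b_def)
  let ?L = "map (\<lambda>e. e + of_real b) E @ map (\<lambda>e. e + of_real (- b)) F"
  have L: "eigenvalue_list (four_block_mat (A + of_real b \<cdot>\<^sub>m 1\<^sub>m n) (0\<^sub>m n n) (0\<^sub>m n n)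
    (B + of_real (- b) \<cdot>\<^sub>m 1\<^sub>m n)) ?L"
    using A B by (intro eigenvalue_list_block eigenvalue_list_shift E F) auto
  have mem: "\<exists>u s. v = u + of_real (s * b) \<and> cmod u \<le> R \<and> (s = 1 \<and> u \<in> set E \<or> s = - 1 \<and> u \<in> set F)"
    if "v \<in> set ?L" for v
  proof -
    have "v \<in> (\<lambda>e. e + of_real b) ` set E \<union> (\<lambda>e. e + of_real (- b)) ` set F" using that by simp
    then consider u where "u \<in> set E" "v = u + of_real b" | u where "u \<in> set F" "v = u + of_real (- b)"
      by blast
    then show ?thesis
    proof cases
      case 1
      then show ?thesis using R by (intro exI[of _ u] exI[of _ 1]) auto
    next
      case 2
      then show ?thesis using R by (intro exI[of _ u] exI[of _ "- 1"]) auto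
    qed
  qed
  have "nondegenerate_gaps (four_block_mat (A + of_real b \<cdot>\<^sub>m 1\<^sub>m n) (0\<^sub>m n n) (0\<^sub>m n n)
    (B + of_real (- b) \<cdot>\<^sub>m 1\<^sub>m n))"
  proof (rule nondegenerate_gapsI[OF L distinct_shifted_union[OF E(2) F(2) R b(1,2)]])
    fix w x y z assume m: "w \<in> set ?L" "x \<in> set ?L" "y \<in> set ?L" "z \<in> set ?L" and ne: "w \<noteq> x"
      and eq: "w - x = y - z"
    obtain w' sw where w: "w = w' + of_real (sw * b)" "cmod w' \<le> R" "sw = 1 \<and> w' \<in> set E \<or> sw = - 1 \<and> w' \<in> set F"
      using mem[OF m(1)] by blast
    obtain x' sx where x: "x = x' + of_real (sx * b)" "cmod x' \<le> R" "sx = 1 \<and> x' \<in> set E \<or> sx = - 1 \<and> x' \<in> set F"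
      using mem[OF m(2)] by blast
    obtain y' sy where y: "y = y' + of_real (sy * b)" "cmod y' \<le> R" "sy = 1 \<and> y' \<in> set E \<or> sy = - 1 \<and> y' \<in> set F"
      using mem[OF m(3)] by blast
    obtain z' sz where z: "z = z' + of_real (sz * b)" "cmod z' \<le> R" "sz = 1 \<and> z' \<in> set E \<or> sz = - 1 \<and> z' \<in> set F"
      using mem[OF m(4)] by blast
    have "of_real ((sw - sx - sy + sz) * b) = (x' - w') + (y' - z')"
      using eq unfolding w(1) x(1) y(1) z(1) by (simp add: algebra_simps)
    then have "\<bar>(sw - sx - sy + sz) * b\<bar> = cmod ((x' - w') + (y' - z'))"
      by (metis norm_of_real)
    also have "\<dots> \<le> (R + R) + (R + R)"
      by (intro norm_triangle_le add_mono order_trans[OF norm_triangle_ineq4] w x y z)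
    finally have "\<bar>sw - sx - sy + sz\<bar> * b \<le> 4 * R" using b(2) by (simp add: abs_mult)
    then have "\<bar>sw - sx - sy + sz\<bar> * b < 2 * b" using b(3) by (rule le_less_trans)
    then have s: "\<bar>sw - sx - sy + sz\<bar> < 2" using b(2) by (rule mult_right_less_imp_less[OF _ less_imp_le])
    \<comment> \<open>A signed sum of four values 1 or - 1 is even and hence zero here. Three
      patterns remain: all energies in one copy, one gap in each copy, or both gaps across the
      copies.\<close>
    consider "sw = sx" "sx = sy" "sy = sz" | "sw = sx" "sx \<noteq> sy" "sy = sz" | "sw = sy" "sx = sz" "sw \<noteq> sx"
      using s w(3) x(3) y(3) z(3) by fastforce
    then show "w = y \<and> x = z"
    proof cases
      case 1
      then have "w' - x' = y' - z'" "w' \<noteq> x'" using eq ne unfolding w(1) x(1) y(1) z(1) by auto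
      then have "w' = y' \<and> x' = z'"
        using gE[of w' x' y' z'] gF[of w' x' y' z'] w(3) x(3) y(3) z(3) 1 by auto
      then show ?thesis using 1 w x y z by simp
    next
      case 2
      then have "w' - x' = y' - z'" "w' \<noteq> x'" using eq ne unfolding w(1) x(1) y(1) z(1) by auto
      then have False
        using EF[of w' x' y' z'] EF[of y' z' w' x'] w(3) x(3) y(3) z(3) 2 by auto
      then show ?thesis ..
    next
      case 3
      \<comment> \<open>Gaps across the copies are rearranged so that a difference inside one copy
        equals a difference inside the other.\<close>
      then have "w' - y' = x' - z'" "x' - z' = w' - y'"
        using eq unfolding w(1) x(1) y(1) z(1) by (auto simp: algebra_simps)
      then have "w' = y' \<and> x' = z'"
        using EF[of w' y' x' z'] EF[of x' z' w' y'] w(3) x(3) y(3) z(3) 3 by auto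
      then show ?thesis using 3 w x y z by simp
    qed
  qed
  then show ?thesis by (rule that)
qed

section \<open>The Ising chain\<close>

lemma dim_kron [simp]:
  "dim_row (kron A B) = dim_row A * dim_row B" "dim_col (kron A B) = dim_col A * dim_col B"
  by (simp_all add: kron_def)

lemma kron_assoc: "kron (kron A B) C = kron A (kron B C)"
proof (rule eq_matI)
  fix r c assume "r < dim_row (kron A (kron B C))" "c < dim_col (kron A (kron B C))"
  then have rc: "r < dim_row A * (dim_row B * dim_row C)" "c < dim_col A * (dim_col B * dim_col C)"
    by simp_all
  have pos: "0 < dim_row B" "0 < dim_row C" "0 < dim_col B" "0 < dim_col C"
    using rc by (auto intro!: Nat.gr0I)
  have lt: "r div dim_row C < dim_row A * dim_row B" "c div dim_col C < dim_col A * dim_col B"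
    using rc by (simp_all add: less_mult_imp_div_less mult.assoc)
  have "r mod (dim_row B * dim_row C) < dim_row B * dim_row C"
    "c mod (dim_col B * dim_col C) < dim_col B * dim_col C"
    using pos by simp_all
  moreover have "m div k mod l = m mod (l * k) div k" if "0 < k" for k l m :: nat
    using that by (simp add: mult.commute[of l k] mod_mult2_eq)
  moreover have "m div k div l = m div (l * k)" for k l m :: nat
    by (simp add: div_mult2_eq mult.commute)
  ultimately show "kron (kron A B) C $$ (r, c) = kron A (kron B C) $$ (r, c)"
    using rc lt pos by (simp add: kron_def mult.assoc mod_mod_cancel)
qed simp_all

lemma kron_one: "kron (1\<^sub>m m) (1\<^sub>m n) = 1\<^sub>m (m * n)"
proof (rule eq_matI)
  fix r c assume "r < dim_row (1\<^sub>m (m * n) :: complex mat)" "c < dim_col (1\<^sub>m (m * n) :: complex mat)"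
  then have rc: "r < m * n" "c < m * n" by simp_all
  then have "0 < n" by (auto intro!: Nat.gr0I)
  moreover have "r div n < m" "c div n < m" using rc by (simp_all add: less_mult_imp_div_less)
  moreover have "r div n = c div n \<and> r mod n = c mod n \<longleftrightarrow> r = c"
    by (metis div_mult_mod_eq)
  ultimately show "kron (1\<^sub>m m) (1\<^sub>m n) $$ (r, c) = 1\<^sub>m (m * n) $$ (r, c)"
    using rc by (auto simp: kron_def)
qed simp_all

lemma kron_one_left: "kron (1\<^sub>m 1) A = A"
  by (rule eq_matI) (auto simp: kron_def)

lemma kron_one_right: "kron A (1\<^sub>m 1) = A"
  by (rule eq_matI) (auto simp: kron_def)

text \<open>A two-dimensional left factor shows up as a division into four blocks; this is how the
  first spin is separated from the rest of a chain.\<close>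

lemma kron_two:
  assumes "A \<in> carrier_mat 2 2" "B \<in> carrier_mat n n"
  shows "kron A B = four_block_mat (A $$ (0, 0) \<cdot>\<^sub>m B) (A $$ (0, 1) \<cdot>\<^sub>m B)
    (A $$ (1, 0) \<cdot>\<^sub>m B) (A $$ (1, 1) \<cdot>\<^sub>m B)" (is "_ = ?R")
proof (rule eq_matI)
  fix r c assume "r < dim_row ?R" "c < dim_col ?R"
  then have rc: "r < n + n" "c < n + n" using assms by simp_all
  have "k div n = (if k < n then 0 else 1)" "k mod n = (if k < n then k else k - n)" if "k < n + n" for k
    using that by (auto simp: div_if le_mod_geq)
  then show "kron A B $$ (r, c) = ?R $$ (r, c)"
    using rc assms by (auto simp: kron_def)
qed (use assms in auto)

lemma pauli_carrier [simp]:
  "pauli_x \<in> carrier_mat 2 2" "pauli_y \<in> carrier_mat 2 2" "pauli_z \<in> carrier_mat 2 2"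
  by (auto simp: pauli_x_def pauli_y_def pauli_z_def mat_of_rows_list_def)

lemma pauli_index:
  "pauli_x $$ (0, 0) = 0" "pauli_x $$ (0, 1) = 1" "pauli_x $$ (1, 0) = 1" "pauli_x $$ (1, 1) = 0"
  "pauli_z $$ (0, 0) = 1" "pauli_z $$ (0, 1) = 0" "pauli_z $$ (1, 0) = 0" "pauli_z $$ (1, 1) = - 1"
  by (auto simp: pauli_x_def pauli_z_def mat_of_rows_list_def)

lemma on_site_carrier:
  assumes "1 \<le> j" "j \<le> N" "S \<in> carrier_mat 2 2"
  shows "on_site N j S \<in> carrier_mat (2 ^ N) (2 ^ N)"
proof -
  have "(2::nat) ^ (j - 1) * 2 * 2 ^ (N - j) = 2 ^ (j - 1 + 1 + (N - j))"
    by (simp only: power_add power_one_right)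
  also have "j - 1 + 1 + (N - j) = N" using assms by simp
  finally have e: "(2::nat) ^ (j - 1) * 2 * 2 ^ (N - j) = 2 ^ N" .
  show ?thesis
    by (rule carrier_matI) (simp_all only: on_site_def dim_kron index_one_mat carrier_matD[OF assms(3)] e)
qed

lemma on_site_first:
  assumes "S \<in> carrier_mat 2 2"
  shows "on_site (Suc N) 1 S = four_block_mat (S $$ (0, 0) \<cdot>\<^sub>m 1\<^sub>m (2 ^ N)) (S $$ (0, 1) \<cdot>\<^sub>m 1\<^sub>m (2 ^ N))
    (S $$ (1, 0) \<cdot>\<^sub>m 1\<^sub>m (2 ^ N)) (S $$ (1, 1) \<cdot>\<^sub>m 1\<^sub>m (2 ^ N))"
  using kron_two[OF assms, of "1\<^sub>m (2 ^ N)" "2 ^ N"] by (simp add: on_site_def kron_one_left del: One_nat_def)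

text \<open>The identity on the leading factors contains a two-dimensional identity for the new
  first spin, so the operator acts alike in both blocks.\<close>

lemma on_site_later:
  assumes "1 \<le> j" "j \<le> N" "S \<in> carrier_mat 2 2"
  shows "on_site (Suc N) (Suc j) S = four_block_mat (on_site N j S) (0\<^sub>m (2 ^ N) (2 ^ N))
    (0\<^sub>m (2 ^ N) (2 ^ N)) (on_site N j S)"
proof -
  have "1\<^sub>m (2 ^ j) = kron (1\<^sub>m 2) (1\<^sub>m (2 ^ (j - 1)))"
    using assms(1) by (cases j) (simp_all add: kron_one)
  then have "on_site (Suc N) (Suc j) S = kron (1\<^sub>m 2) (on_site N j S)"
    by (simp add: on_site_def kron_assoc)
  moreover have "0 \<cdot>\<^sub>m on_site N j S = 0\<^sub>m (2 ^ N) (2 ^ N)" "1 \<cdot>\<^sub>m on_site N j S = on_site N j S"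
    using on_site_carrier[OF assms] by auto
  ultimately show ?thesis using kron_two[OF one_carrier_mat on_site_carrier[OF assms]] by simp
qed

lemma on_site_one: "S \<in> carrier_mat 2 2 \<Longrightarrow> on_site 1 1 S = S"
  by (simp add: on_site_def kron_one_left kron_one_right del: One_nat_def)

text \<open>The terms of the Hamiltonian that carry parameters, with all strengths set to 1. The
  parameters range over all reals, so strengths can be absorbed into them.\<close>

definition ising :: "nat \<Rightarrow> (param \<Rightarrow> real) \<Rightarrow> complex mat" where
  "ising N \<gamma> =
     mat_sum (2 ^ N) (\<lambda>j. complex_of_real (\<gamma> (GX j)) \<cdot>\<^sub>m on_site N j pauli_x
       + complex_of_real (\<gamma> (GZ j)) \<cdot>\<^sub>m on_site N j pauli_z) {1..N}
   + mat_sum (2 ^ N) (\<lambda>j. complex_of_real (\<gamma> (GZZ j)) \<cdot>\<^sub>m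
           (on_site N j pauli_z * on_site N (j + 1) pauli_z)) {1..<N}"

lemma ising_carrier [simp]: "ising N \<gamma> \<in> carrier_mat (2 ^ N) (2 ^ N)"
  by (rule carrier_matI) (simp_all add: ising_def mat_sum_def)

lemma ising_index:
  assumes "r < 2 ^ N" "c < 2 ^ N"
  shows "ising N \<gamma> $$ (r, c) = (\<Sum>j\<in>{1..N}. of_real (\<gamma> (GX j)) * on_site N j pauli_x $$ (r, c)
       + of_real (\<gamma> (GZ j)) * on_site N j pauli_z $$ (r, c))
     + (\<Sum>j\<in>{1..<N}. of_real (\<gamma> (GZZ j)) * (on_site N j pauli_z * on_site N (j + 1) pauli_z) $$ (r, c))"
proof -
  have 1: "(of_real (\<gamma> (GX j)) \<cdot>\<^sub>m on_site N j pauli_x + of_real (\<gamma> (GZ j)) \<cdot>\<^sub>m on_site N j pauli_z) $$ (r, c)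
     = of_real (\<gamma> (GX j)) * on_site N j pauli_x $$ (r, c) + of_real (\<gamma> (GZ j)) * on_site N j pauli_z $$ (r, c)"
    if "j \<in> {1..N}" for j
  proof -
    have j: "1 \<le> j" "j \<le> N" using that by auto
    show ?thesis using assms on_site_carrier[OF j pauli_carrier(1)] on_site_carrier[OF j pauli_carrier(3)]
      by simp
  qed
  have 2: "(of_real (\<gamma> (GZZ j)) \<cdot>\<^sub>m (on_site N j pauli_z * on_site N (j + 1) pauli_z)) $$ (r, c)
     = of_real (\<gamma> (GZZ j)) * (on_site N j pauli_z * on_site N (j + 1) pauli_z) $$ (r, c)"
    if "j \<in> {1..<N}" for j
  proof -
    have j: "1 \<le> j" "j \<le> N" "1 \<le> j + 1" "j + 1 \<le> N" using that by auto
    show ?thesis using assms on_site_carrier[OF j(1,2) pauli_carrier(3)] on_site_carrier[OF j(3,4) pauli_carrier(3)]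
      by simp
  qed
  show ?thesis unfolding ising_def using assms by (simp add: mat_sum_def 1 2[unfolded Suc_eq_plus1[symmetric]])
qed

lemma ising_field_index:
  assumes "1 \<le> N" "r < 2 ^ N" "c < 2 ^ N"
  shows "ising N (\<gamma>(GZ 1 := \<gamma> (GZ 1) + d)) $$ (r, c) =
    ising N \<gamma> $$ (r, c) + of_real d * on_site N 1 pauli_z $$ (r, c)"
proof -
  let ?\<gamma> = "\<gamma>(GZ 1 := \<gamma> (GZ 1) + d)"
  have "(\<Sum>j\<in>{1..N}. of_real (?\<gamma> (GX j)) * on_site N j pauli_x $$ (r, c)
       + of_real (?\<gamma> (GZ j)) * on_site N j pauli_z $$ (r, c)) =
    (\<Sum>j\<in>{1..N}. (of_real (\<gamma> (GX j)) * on_site N j pauli_x $$ (r, c)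
       + of_real (\<gamma> (GZ j)) * on_site N j pauli_z $$ (r, c))
       + (if j = 1 then of_real d * on_site N j pauli_z $$ (r, c) else 0))"
    by (intro sum.cong) (auto simp: algebra_simps)
  also have "\<dots> = (\<Sum>j\<in>{1..N}. (of_real (\<gamma> (GX j)) * on_site N j pauli_x $$ (r, c)
       + of_real (\<gamma> (GZ j)) * on_site N j pauli_z $$ (r, c)))
       + of_real d * on_site N 1 pauli_z $$ (r, c)"
    using assms(1) by (simp add: sum.distrib)
  finally show ?thesis using assms by (simp add: ising_index)
qed

text \<open>A spin is attached on the left: \<open>a\<close> and \<open>b\<close> are its transverse
  and longitudinal fields, \<open>c\<close> is its coupling to the old first spin, and every old
  label moves up by one.\<close>

definition extend_params :: "real \<Rightarrow> real \<Rightarrow> real \<Rightarrow> (param \<Rightarrow> real) \<Rightarrow> param \<Rightarrow> real" where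
  "extend_params a b c \<gamma> p = (case p of GX j \<Rightarrow> if j = 1 then a else \<gamma> (GX (j - 1))
     | GZ j \<Rightarrow> if j = 1 then b else \<gamma> (GZ (j - 1)) | GZZ j \<Rightarrow> if j = 1 then c else \<gamma> (GZZ (j - 1)))"

text \<open>The Pauli z matrix of the new spin is 1 on the first block and - 1 on the second. Hence
  its field shifts the blocks by \<open>b\<close> and \<open>- b\<close>, its coupling changes the
  old first field by \<open>c\<close> and \<open>- c\<close>, and only the transverse field
  \<open>a\<close> connects the blocks.\<close>

lemma ising_extend_params:
  assumes N: "1 \<le> N"
  shows "ising (Suc N) (extend_params a b c \<gamma>) = four_block_mat
    (ising N (\<gamma>(GZ 1 := \<gamma> (GZ 1) + c)) + of_real b \<cdot>\<^sub>m 1\<^sub>m (2 ^ N))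
    (of_real a \<cdot>\<^sub>m 1\<^sub>m (2 ^ N)) (of_real a \<cdot>\<^sub>m 1\<^sub>m (2 ^ N))
    (ising N (\<gamma>(GZ 1 := \<gamma> (GZ 1) + - c)) + of_real (- b) \<cdot>\<^sub>m 1\<^sub>m (2 ^ N))" (is "ising _ ?\<delta> = ?R")
proof (rule eq_matI)
  let ?n = "2 ^ N :: nat"
  have cz: "on_site N j pauli_z \<in> carrier_mat ?n ?n" if "1 \<le> j" "j \<le> N" for j
    using on_site_carrier[OF that] by simp
  have cx: "on_site N j pauli_x \<in> carrier_mat ?n ?n" if "1 \<le> j" "j \<le> N" for j
    using on_site_carrier[OF that] by simp
  note cz1 = cz[OF order_refl N]
  fix r s assume "r < dim_row ?R" "s < dim_col ?R"
  then have rc: "r < ?n + ?n" "s < ?n + ?n" by simp_all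
  have zz: "on_site (Suc N) (Suc j) pauli_z * on_site (Suc N) (Suc (Suc j)) pauli_z =
      four_block_mat (on_site N j pauli_z * on_site N (Suc j) pauli_z) (0\<^sub>m ?n ?n) (0\<^sub>m ?n ?n)
        (on_site N j pauli_z * on_site N (Suc j) pauli_z)" if "1 \<le> j" "j < N" for j
  proof -
    have c: "on_site N j pauli_z \<in> carrier_mat ?n ?n" "on_site N (Suc j) pauli_z \<in> carrier_mat ?n ?n"
      using cz that by auto
    then show ?thesis
      using that by (simp add: on_site_later mult_four_block_mat[where ?nr1.0 = ?n and ?n1.0 = ?n and ?n2.0 = ?n
            and ?nr2.0 = ?n and ?nc1.0 = ?n and ?nc2.0 = ?n])
  qed
  \<comment> \<open>The only coupling that involves the new spin; it turns into opposite fields at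
    the old first site.\<close>
  have zz1: "on_site (Suc N) 1 pauli_z * on_site (Suc N) (Suc 1) pauli_z =
      four_block_mat (on_site N 1 pauli_z) (0\<^sub>m ?n ?n) (0\<^sub>m ?n ?n) (- on_site N 1 pauli_z)"
  proof -
    have [simp]: "0 \<cdot>\<^sub>m 1\<^sub>m ?n = (0\<^sub>m ?n ?n :: complex mat)" "1 \<cdot>\<^sub>m 1\<^sub>m ?n = (1\<^sub>m ?n :: complex mat)" by auto
    have "(- 1 \<cdot>\<^sub>m 1\<^sub>m ?n) * on_site N 1 pauli_z = - on_site N 1 pauli_z"
      using cz1 by (subst mult_smult_assoc_mat[of _ ?n ?n _ ?n]) auto
    then show ?thesis
      unfolding on_site_first[OF pauli_carrier(3)] on_site_later[OF order_refl N pauli_carrier(3)] pauli_index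
      using cz1 by (subst mult_four_block_mat[where ?nr1.0 = ?n and ?n1.0 = ?n and ?n2.0 = ?n
            and ?nr2.0 = ?n and ?nc1.0 = ?n and ?nc2.0 = ?n]) auto
  qed
  have split1: "(\<Sum>j\<in>{1..Suc N}. f j) = f 1 + (\<Sum>j\<in>{1..N}. f (Suc j))" for f :: "nat \<Rightarrow> complex"
    by (subst sum.atLeast_Suc_atMost) (auto simp: sum.shift_bounds_cl_Suc_ivl simp del: sum.cl_ivl_Suc)
  have split2: "(\<Sum>j\<in>{1..<Suc N}. f j) = f 1 + (\<Sum>j\<in>{1..<N}. f (Suc j))" for f :: "nat \<Rightarrow> complex"
    using N by (subst sum.atLeast_Suc_lessThan) (auto simp: sum.shift_bounds_Suc_ivl simp del: sum.op_ivl_Suc)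
  have tail: "(\<Sum>j\<in>{1..N}. of_real (?\<delta> (GX (Suc j))) * on_site N j pauli_x $$ (r', s')
       + of_real (?\<delta> (GZ (Suc j))) * on_site N j pauli_z $$ (r', s'))
     + (\<Sum>j\<in>{1..<N}. of_real (?\<delta> (GZZ (Suc j))) * (on_site N j pauli_z * on_site N (j + 1) pauli_z) $$ (r', s'))
     = ising N \<gamma> $$ (r', s')" if "r' < ?n" "s' < ?n" for r' s'
  proof -
    have "?\<delta> (GX (Suc j)) = \<gamma> (GX j)" "?\<delta> (GZ (Suc j)) = \<gamma> (GZ j)" "?\<delta> (GZZ (Suc j)) = \<gamma> (GZZ j)"
      if "1 \<le> j" for j using that by (simp_all add: extend_params_def)
    then show ?thesis using that by (simp add: ising_index)
  qed
  have block: "r < ?n \<and> s < ?n \<or> r < ?n \<and> s \<ge> ?n \<and> s - ?n < ?n \<or> r \<ge> ?n \<and> r - ?n < ?n \<and> s < ?n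
     \<or> r \<ge> ?n \<and> r - ?n < ?n \<and> s \<ge> ?n \<and> s - ?n < ?n"
    using rc by linarith
  have S: "on_site (Suc N) (Suc j) S $$ (r, s) = (if r < ?n \<and> s < ?n then on_site N j S $$ (r, s)
      else if r \<ge> ?n \<and> s \<ge> ?n then on_site N j S $$ (r - ?n, s - ?n) else 0)"
    if "j \<in> {1..N}" "S \<in> carrier_mat 2 2" for j S
  proof -
    have j: "1 \<le> j" "j \<le> N" using that by auto
    show ?thesis
      using rc block on_site_carrier[OF j that(2)] by (auto simp: on_site_later[OF j that(2)])
  qed
  have ZZ: "(on_site (Suc N) (Suc j) pauli_z * on_site (Suc N) (Suc j + 1) pauli_z) $$ (r, s) =
     (if r < ?n \<and> s < ?n then (on_site N j pauli_z * on_site N (j + 1) pauli_z) $$ (r, s)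
      else if r \<ge> ?n \<and> s \<ge> ?n then (on_site N j pauli_z * on_site N (j + 1) pauli_z) $$ (r - ?n, s - ?n) else 0)"
    if "j \<in> {1..<N}" for j
  proof -
    have c: "on_site N j pauli_z \<in> carrier_mat ?n ?n" "on_site N (Suc j) pauli_z \<in> carrier_mat ?n ?n"
      using cz that by auto
    have j: "1 \<le> j" "j < N" using that by auto
    show ?thesis using rc block c zz[OF j] by (auto simp del: index_mult_mat(1))
  qed
  have "ising (Suc N) ?\<delta> $$ (r, s) =
      of_real (?\<delta> (GX 1)) * on_site (Suc N) 1 pauli_x $$ (r, s)
    + of_real (?\<delta> (GZ 1)) * on_site (Suc N) 1 pauli_z $$ (r, s)
    + of_real (?\<delta> (GZZ 1)) * (on_site (Suc N) 1 pauli_z * on_site (Suc N) (Suc 1) pauli_z) $$ (r, s)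
    + ((\<Sum>j\<in>{1..N}. of_real (?\<delta> (GX (Suc j))) * on_site (Suc N) (Suc j) pauli_x $$ (r, s)
       + of_real (?\<delta> (GZ (Suc j))) * on_site (Suc N) (Suc j) pauli_z $$ (r, s))
     + (\<Sum>j\<in>{1..<N}. of_real (?\<delta> (GZZ (Suc j))) *
         (on_site (Suc N) (Suc j) pauli_z * on_site (Suc N) (Suc j + 1) pauli_z) $$ (r, s)))"
    using rc by (subst ising_index) (simp_all only: split1 split2, simp_all add: algebra_simps)
  also have "((\<Sum>j\<in>{1..N}. of_real (?\<delta> (GX (Suc j))) * on_site (Suc N) (Suc j) pauli_x $$ (r, s)
       + of_real (?\<delta> (GZ (Suc j))) * on_site (Suc N) (Suc j) pauli_z $$ (r, s))
     + (\<Sum>j\<in>{1..<N}. of_real (?\<delta> (GZZ (Suc j))) *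
         (on_site (Suc N) (Suc j) pauli_z * on_site (Suc N) (Suc j + 1) pauli_z) $$ (r, s)))
     = (if r < ?n \<and> s < ?n then ising N \<gamma> $$ (r, s)
      else if r \<ge> ?n \<and> s \<ge> ?n then ising N \<gamma> $$ (r - ?n, s - ?n) else 0)"
    using block by (elim disjE conjE) (simp_all only: S[OF _ pauli_carrier(1)] S[OF _ pauli_carrier(3)] ZZ tail
        cong: sum.cong, simp_all add: tail[simplified])
  finally have *: "ising (Suc N) ?\<delta> $$ (r, s) =
      of_real (?\<delta> (GX 1)) * on_site (Suc N) 1 pauli_x $$ (r, s)
    + of_real (?\<delta> (GZ 1)) * on_site (Suc N) 1 pauli_z $$ (r, s)
    + of_real (?\<delta> (GZZ 1)) * (on_site (Suc N) 1 pauli_z * on_site (Suc N) (Suc 1) pauli_z) $$ (r, s)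
    + (if r < ?n \<and> s < ?n then ising N \<gamma> $$ (r, s)
      else if r \<ge> ?n \<and> s \<ge> ?n then ising N \<gamma> $$ (r - ?n, s - ?n) else 0)" .
  define A1 where "A1 = ising N (\<gamma>(GZ 1 := \<gamma> (GZ 1) + c))"
  define A2 where "A2 = ising N (\<gamma>(GZ 1 := \<gamma> (GZ 1) + - c))"
  have A: "A1 \<in> carrier_mat ?n ?n" "A2 \<in> carrier_mat ?n ?n"
    unfolding A1_def A2_def by (rule ising_carrier)+
  have A1: "A1 $$ (i, j) = ising N \<gamma> $$ (i, j) + of_real c * on_site N 1 pauli_z $$ (i, j)"
    if "i < ?n" "j < ?n" for i j unfolding A1_def by (rule ising_field_index[OF N that])
  have A2: "A2 $$ (i, j) = ising N \<gamma> $$ (i, j) + of_real (- c) * on_site N 1 pauli_z $$ (i, j)"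
    if "i < ?n" "j < ?n" for i j unfolding A2_def by (rule ising_field_index[OF N that])
  have \<delta>: "?\<delta> (GX 1) = a" "?\<delta> (GZ 1) = b" "?\<delta> (GZZ 1) = c"
    by (simp_all add: extend_params_def)
  show "ising (Suc N) ?\<delta> $$ (r, s) = ?R $$ (r, s)"
    unfolding * zz1
    unfolding on_site_first[OF pauli_carrier(3)] on_site_first[OF pauli_carrier(1)] pauli_index \<delta>
      A1_def[symmetric] A2_def[symmetric]
    using block
    by (elim disjE conjE) (simp_all add: carrier_matD[OF A(1)] carrier_matD[OF A(2)] A1 A2
        carrier_matD[OF cz1] del: One_nat_def)
qed (simp_all add: carrier_matD[OF ising_carrier])

section \<open>Generic gaps of the Ising chain\<close>

lemma eventually_at_top_not_in_finite:
  fixes S :: "real set"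
  assumes "finite S"
  shows "eventually (\<lambda>x. x \<notin> S) at_top"
proof -
  obtain m where m: "\<And>x. x \<in> S \<Longrightarrow> x \<le> m"
    using bounded_imp_bdd_above[OF finite_imp_bounded[OF assms]] by (auto simp: bdd_above_def)
  show ?thesis by (rule eventually_mono[OF eventually_gt_at_top[of m]]) (use m in force)
qed

text \<open>Conjugation by the Hadamard matrix on the first tensor factor.\<close>

lemma eigenvalue_hadamard:
  fixes M W :: "complex mat"
  assumes M: "M \<in> carrier_mat n n" and W: "W \<in> carrier_mat n n"
  shows "eigenvalue (four_block_mat (M + W) (a \<cdot>\<^sub>m 1\<^sub>m n) (a \<cdot>\<^sub>m 1\<^sub>m n) (M - W)) x \<longleftrightarrow>
    eigenvalue (four_block_mat (M + a \<cdot>\<^sub>m 1\<^sub>m n) W W (M + (- a) \<cdot>\<^sub>m 1\<^sub>m n)) x"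
    (is "eigenvalue ?C x \<longleftrightarrow> eigenvalue ?C' x")
proof -
  let ?I = "1\<^sub>m n :: complex mat"
  \<comment> \<open>\<open>H\<close> is left without its normalising factor, so its inverse
    \<open>G\<close> is half of \<open>H\<close>.\<close>
  define H where "H = four_block_mat ?I ?I ?I (- ?I)"
  define G where "G = four_block_mat ((1/2) \<cdot>\<^sub>m ?I) ((1/2) \<cdot>\<^sub>m ?I) ((1/2) \<cdot>\<^sub>m ?I) ((- 1/2) \<cdot>\<^sub>m ?I)"
  have carr: "?C \<in> carrier_mat (n + n) (n + n)" "?C' \<in> carrier_mat (n + n) (n + n)"
    "H \<in> carrier_mat (n + n) (n + n)" "G \<in> carrier_mat (n + n) (n + n)"
    using M W by (simp_all add: H_def G_def minus_carrier_mat)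
  note mult = mult_four_block_mat[where ?nr1.0 = n and ?n1.0 = n and ?n2.0 = n
            and ?nr2.0 = n and ?nc1.0 = n and ?nc2.0 = n]
  have neg: "(- ?I) * A = - A" if "A \<in> carrier_mat n n" for A :: "complex mat"
    using that by (subst uminus_mult_left_mat) auto
  have right: "A * (c \<cdot>\<^sub>m ?I) = c \<cdot>\<^sub>m A" if "A \<in> carrier_mat n n" for A :: "complex mat" and c
    using that by (subst mult_smult_distrib[of _ n n _ n]) auto
  have HG: "H * G = 1\<^sub>m (n + n)"
    unfolding H_def G_def
    by (subst mult) (auto simp: neg right intro!: eq_matI)
  have GH: "G * H = 1\<^sub>m (n + n)"
    using mat_mult_left_right_inverse[OF carr(3,4) HG] .
  have "H * ?C' = four_block_mat (M + a \<cdot>\<^sub>m ?I + W) (W + (M + (- a) \<cdot>\<^sub>m ?I)) (M + a \<cdot>\<^sub>m ?I - W) (W - (M + (- a) \<cdot>\<^sub>m ?I))"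
    unfolding H_def using M W
    by (subst mult) (auto simp: neg intro!: cong_four_block_mat eq_matI)
  moreover have "\<dots> * G = ?C"
    unfolding G_def using M W
    by (subst mult) (auto simp: right algebra_simps intro!: cong_four_block_mat eq_matI)
  ultimately have eq: "?C = H * ?C' * G" by simp
  have "similar_mat_wit ?C ?C' H G"
    unfolding similar_mat_wit_def Let_def carrier_matD(1)[OF carr(1)]
    by (intro conjI HG GH eq) (use carr in simp)
  then have "char_poly ?C = char_poly ?C'"
    by (intro char_poly_similar) (auto simp: similar_mat_def)
  then show ?thesis
    using eigenvalue_root_char_poly[OF carr(1)] eigenvalue_root_char_poly[OF carr(2)] by simp
qed

text \<open>If the claim fails, two limits produce a gap of \<open>M\<close> that also belongs to
  \<open>M1\<close> or \<open>M2\<close>. For fixed large \<alpha>, the matrices at all large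
  \<beta> share a gap with the one at a reference value \<open>\<beta>0\<close>; one gap recurs and
  is found in \<open>M1\<close> or \<open>M2\<close>. So for all large \<alpha> the matrix at
  \<open>\<beta>0\<close> has a gap from this finite set; one recurs, and after the Hadamard
  transformation it is found in \<open>M\<close>.\<close>

lemma gap_independent_block:
  fixes M M1 M2 :: "complex mat"
  assumes M: "M \<in> carrier_mat n n" "M1 \<in> carrier_mat n n" "M2 \<in> carrier_mat n n" and n: "0 < n"
    and mid: "M1 + M2 = M + M"
    and ind: "gap_independent M M1" "gap_independent M M2"
  defines "C \<equiv> \<lambda>\<alpha> \<beta>. four_block_mat (M1 + complex_of_real \<beta> \<cdot>\<^sub>m 1\<^sub>m n) (complex_of_real \<alpha> \<cdot>\<^sub>m 1\<^sub>m n)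
    (complex_of_real \<alpha> \<cdot>\<^sub>m 1\<^sub>m n) (M2 + complex_of_real (- \<beta>) \<cdot>\<^sub>m 1\<^sub>m n)"
  shows "\<exists>\<alpha> \<beta> \<beta>'. gap_independent (C \<alpha> \<beta>) (C \<alpha> \<beta>')"
proof (rule ccontr)
  assume "\<nexists>\<alpha> \<beta> \<beta>'. gap_independent (C \<alpha> \<beta>) (C \<alpha> \<beta>')"
  have C: "C \<alpha> \<beta> \<in> carrier_mat (n + n) (n + n)" for \<alpha> \<beta>
    using M by (simp add: C_def)
  have n2: "0 < n + n" using n by simp
  have no: "\<not> (simple_spectrum (C \<alpha> \<beta>) \<and> simple_spectrum (C \<alpha> \<beta>') \<and> gaps (C \<alpha> \<beta>) \<inter> gaps (C \<alpha> \<beta>') = {})"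
    for \<alpha> \<beta> \<beta>'
    using \<open>\<nexists>\<alpha> \<beta> \<beta>'. gap_independent (C \<alpha> \<beta>) (C \<alpha> \<beta>')\<close> gap_independent_iff[OF C C n2 n2] by blast
  have entry: "C \<alpha> \<beta> $$ (i, j) = (if i < n then
      if j < n then M1 $$ (i, j) + (if i = j then of_real \<beta> else 0) else if i = j - n then of_real \<alpha> else 0
      else if j < n then if i - n = j then of_real \<alpha> else 0
      else M2 $$ (i - n, j - n) + (if i = j then of_real (- \<beta>) else 0))"
    if "i < n + n" "j < n + n" for \<alpha> \<beta> i j
    using that M by (auto simp: C_def)
  note [intro] = real_polynomials.const real_polynomials_of_real
  have poly1: "(\<lambda>\<alpha>. C \<alpha> \<beta> $$ (i, j)) \<in> real_polynomials" if "i < n + n" "j < n + n" for i j \<beta>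
    unfolding entry[OF that] by (cases "i < n"; cases "j < n"; cases "i = j - n"; cases "i - n = j") auto
  have poly2: "(\<lambda>\<beta>. C \<alpha> \<beta> $$ (i, j)) \<in> real_polynomials" if "i < n + n" "j < n + n" for i j \<alpha>
    unfolding entry[OF that] of_real_minus
    by (cases "i < n"; cases "j < n"; cases "i = j"; cases "i = j - n"; cases "i - n = j")
      (auto intro!: real_polynomials.add real_polynomials.uminus)
  have simpleM: "simple_spectrum M1" "simple_spectrum M2"
    and disj: "gaps M \<inter> (gaps M1 \<union> gaps M2) = {}"
    using ind gap_independent_iff[OF M(1) M(2) n n] gap_independent_iff[OF M(1) M(3) n n] by auto
  \<comment> \<open>At \<alpha> = 0 the matrix is block diagonal, and a shift beyond the size of
    both simple spectra makes the whole spectrum simple.\<close>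
  obtain \<beta>0 where \<beta>0: "simple_spectrum (C 0 \<beta>0)"
  proof -
    obtain E F where E: "eigenvalue_list M1 E" "distinct E" and F: "eigenvalue_list M2 F" "distinct F"
      using simpleM unfolding simple_spectrum_def by blast
    define R where "R = (\<Sum>x\<in>set E \<union> set F. cmod x)"
    have R: "cmod x \<le> R" if "x \<in> set E \<union> set F" for x
      unfolding R_def using that by (intro member_le_sum) auto
    have R0: "0 \<le> R" unfolding R_def by (rule sum_nonneg) simp
    have z: "complex_of_real 0 \<cdot>\<^sub>m 1\<^sub>m n = 0\<^sub>m n n" by auto
    have "eigenvalue_list (C 0 (R + 1))
      (map (\<lambda>e. e + of_real (R + 1)) E @ map (\<lambda>e. e + of_real (- (R + 1))) F)"
      unfolding C_def z using M by (intro eigenvalue_list_block eigenvalue_list_shift E F) auto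
    moreover have "distinct (map (\<lambda>e. e + of_real (R + 1)) E @ map (\<lambda>e. e + of_real (- (R + 1))) F)"
      by (rule distinct_shifted_union[OF E(2) F(2) R]) (use R0 in auto)
    ultimately have "simple_spectrum (C 0 (R + 1))" unfolding simple_spectrum_def by blast
    then show ?thesis by (rule that)
  qed
  have ev_limit: "g \<in> gaps M1 \<union> gaps M2" if g: "g \<noteq> 0" "\<exists>\<^sub>F \<beta> in at_top. g \<in> gaps (C \<alpha> \<beta>)" for g \<alpha>
  proof -
    have "\<exists>\<^sub>F \<beta> in at_top. \<exists>a. eigenvalue (C \<alpha> \<beta>) a \<and> eigenvalue (C \<alpha> \<beta>) (a - g)"
      using g(2) by (rule frequently_mono[rotated]) (auto simp: gaps_def)
    then have "\<exists>M x. (M = M1 \<or> M = M2) \<and> eigenvalue M x \<and> eigenvalue M (x - g)"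
      unfolding C_def by (intro block_gap_limit[OF M(2,3)]) auto
    then show ?thesis using g(1) by (auto simp: gaps_def)
  qed
  have fin: "finite (gaps M1 \<union> gaps M2)" using finite_gaps M by blast
  have "eventually (\<lambda>\<alpha>. simple_spectrum (C \<alpha> \<beta>0)) at_top"
    using eventually_at_top_not_in_finite[OF finite_not_simple_spectrum[OF C poly1 n2 \<beta>0]] by simp
  then have "eventually (\<lambda>\<alpha>. \<exists>g\<in>gaps M1 \<union> gaps M2. g \<in> gaps (C \<alpha> \<beta>0)) at_top"
  proof eventually_elim
    case (elim \<alpha>)
    have "eventually (\<lambda>\<beta>. simple_spectrum (C \<alpha> \<beta>)) at_top"
      using eventually_at_top_not_in_finite[OF finite_not_simple_spectrum[OF C poly2 n2 elim]] by simp
    then have "eventually (\<lambda>\<beta>. \<exists>g\<in>gaps (C \<alpha> \<beta>0). g \<in> gaps (C \<alpha> \<beta>)) at_top"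
      by eventually_elim (use no[of \<alpha> _ \<beta>0] elim in blast)
    then have "\<exists>\<^sub>F \<beta> in at_top. \<exists>g\<in>gaps (C \<alpha> \<beta>0). g \<in> gaps (C \<alpha> \<beta>)"
      by (intro eventually_frequently) auto
    \<comment> \<open>As \<open>C \<alpha> \<beta>0\<close> has finitely many gaps, one of them
      recurs for arbitrarily large \<beta>.\<close>
    then obtain g where g: "g \<in> gaps (C \<alpha> \<beta>0)" "\<exists>\<^sub>F \<beta> in at_top. g \<in> gaps (C \<alpha> \<beta>)"
      unfolding frequently_bex_finite_distrib[OF finite_gaps[OF C]] by blast
    then have "g \<noteq> 0" by (simp add: gaps_def)
    then show ?case using ev_limit[OF _ g(2)] g(1) by blast
  qed
  then have "\<exists>\<^sub>F \<alpha> in at_top. \<exists>g\<in>gaps M1 \<union> gaps M2. g \<in> gaps (C \<alpha> \<beta>0)"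
    by (intro eventually_frequently) auto
  then obtain g where g: "g \<in> gaps M1 \<union> gaps M2" and fr: "\<exists>\<^sub>F \<alpha> in at_top. g \<in> gaps (C \<alpha> \<beta>0)"
    unfolding frequently_bex_finite_distrib[OF fin] by blast
  \<comment> \<open>By \<open>mid\<close>, the diagonal blocks at \<open>\<beta>0\<close> are
    \<open>M + W\<close> and \<open>M - W\<close>; the Hadamard transformation then moves \<alpha>
    onto the diagonal, where the limit lemma applies.\<close>
  define W where "W = M1 - M + complex_of_real \<beta>0 \<cdot>\<^sub>m 1\<^sub>m n"
  have W: "W \<in> carrier_mat n n" using M by (simp add: W_def)
  have mid': "M1 $$ (i, j) + M2 $$ (i, j) = M $$ (i, j) + M $$ (i, j)" if "i < n" "j < n" for i j
    using arg_cong[OF mid, of "\<lambda>A. A $$ (i, j)"] that M by simp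
  have "C \<alpha> \<beta>0 = four_block_mat (M + W) (complex_of_real \<alpha> \<cdot>\<^sub>m 1\<^sub>m n) (complex_of_real \<alpha> \<cdot>\<^sub>m 1\<^sub>m n) (M - W)" for \<alpha>
  proof -
    have "M1 + complex_of_real \<beta>0 \<cdot>\<^sub>m 1\<^sub>m n = M + W"
      by (rule eq_matI) (use M in \<open>auto simp: W_def\<close>)
    moreover have "M2 + complex_of_real (- \<beta>0) \<cdot>\<^sub>m 1\<^sub>m n = M - W"
    proof (rule eq_matI)
      fix i j assume "i < dim_row (M - W)" "j < dim_col (M - W)"
      then have ij: "i < n" "j < n" using W by simp_all
      have "M2 $$ (i, j) = M $$ (i, j) + M $$ (i, j) - M1 $$ (i, j)"
        using mid'[OF ij] by (simp add: algebra_simps)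
      then show "(M2 + complex_of_real (- \<beta>0) \<cdot>\<^sub>m 1\<^sub>m n) $$ (i, j) = (M - W) $$ (i, j)"
        using ij M by (simp add: W_def)
    qed (use M W in auto)
    ultimately show ?thesis by (simp add: C_def)
  qed
  then have "\<exists>\<^sub>F \<alpha> in at_top. \<exists>a.
      eigenvalue (four_block_mat (M + of_real \<alpha> \<cdot>\<^sub>m 1\<^sub>m n) W W (M + of_real (- \<alpha>) \<cdot>\<^sub>m 1\<^sub>m n)) a \<and>
      eigenvalue (four_block_mat (M + of_real \<alpha> \<cdot>\<^sub>m 1\<^sub>m n) W W (M + of_real (- \<alpha>) \<cdot>\<^sub>m 1\<^sub>m n)) (a - g)"
    using fr by (elim frequently_mono[rotated]) (simp add: gaps_def eigenvalue_hadamard[OF M(1) W])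
  then have "\<exists>x. eigenvalue M x \<and> eigenvalue M (x - g)"
    using block_gap_limit[OF M(1) M(1) W W] by blast
  then have "g \<in> gaps M" using g by (auto simp: gaps_def)
  then show False using g disj by blast
qed

lemma (in function_algebra) ising_entry:
  assumes "\<And>p. p \<in> params N \<Longrightarrow> (\<lambda>x. complex_of_real (\<gamma> x p)) \<in> P" and "r < 2 ^ N" "c < 2 ^ N"
  shows "(\<lambda>x. ising N (\<gamma> x) $$ (r, c)) \<in> P"
  unfolding ising_index[OF assms(2,3)]
  by (intro add sum mult const assms(1)) (auto simp: params_def)

lemma real_polynomials_affine: "(\<lambda>t. complex_of_real (u + t * v)) \<in> real_polynomials"
  by (rule real_polynomialsI[of _ "[:of_real u, of_real v:]"]) simp

lemma real_polynomials_field: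
  assumes "\<And>p. (\<lambda>t. complex_of_real (\<gamma> t p)) \<in> real_polynomials" "(\<lambda>t. complex_of_real (b t)) \<in> real_polynomials"
  shows "(\<lambda>t. complex_of_real (((\<gamma> t)(q := b t)) p)) \<in> real_polynomials"
  using assms by (cases "p = q") simp_all

lemma eigenvalue_list_ising_1:
  assumes "\<gamma> (GX 1) = 0"
  shows "eigenvalue_list (ising 1 \<gamma>) [of_real (\<gamma> (GZ 1)), - of_real (\<gamma> (GZ 1))]"
proof -
  have e: "ising 1 \<gamma> $$ (r, c) = of_real (\<gamma> (GZ 1)) * pauli_z $$ (r, c)" if "r < 2" "c < 2" for r c
    using that assms by (subst ising_index) (simp_all add: on_site_one[unfolded One_nat_def])
  have c: "ising 1 \<gamma> \<in> carrier_mat 2 2" using ising_carrier[of 1 \<gamma>] by simp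
  have "upper_triangular (ising 1 \<gamma>)"
  proof (rule upper_triangularI)
    fix i j assume "j < i" "i < dim_row (ising 1 \<gamma>)"
    then have "i = 1" "j = 0" using c by auto
    then show "ising 1 \<gamma> $$ (i, j) = 0" using e[of i j] pauli_index by simp
  qed
  moreover have "diag_mat (ising 1 \<gamma>) = [of_real (\<gamma> (GZ 1)), - of_real (\<gamma> (GZ 1))]"
    using c e[of 0 0] e[of 1 1] pauli_index by (simp add: diag_mat_def upt_rec)
  ultimately show ?thesis
    using char_poly_upper_triangular[OF c] unfolding eigenvalue_list_def by metis
qed

text \<open>The first claim at \<open>Suc N\<close> needs two chains of length \<open>N\<close> that
  differ only in the first longitudinal field and have no common gap; the second claim supplies
  them.\<close>

lemma ising_generic_gaps:
  "1 \<le> N \<Longrightarrow> (\<exists>\<gamma>. nondegenerate_gaps (ising N \<gamma>)) \<and>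
    (\<exists>\<gamma> \<beta>. gap_independent (ising N \<gamma>) (ising N (\<gamma>(GZ 1 := \<beta>))))"
proof (induction N rule: nat_induct_at_least)
  case base
  \<comment> \<open>Fields 1 and 2 give the spectra {1, - 1} and {2, - 2}, with nonzero gaps
    \<plusminus>2 and \<plusminus>4.\<close>
  define \<gamma> where "\<gamma> = (\<lambda>p. case p of GZ _ \<Rightarrow> 1 | _ \<Rightarrow> (0 :: real))"
  have E: "eigenvalue_list (ising 1 \<gamma>) [1, - 1]"
    using eigenvalue_list_ising_1[of \<gamma>] by (simp add: \<gamma>_def)
  have F: "eigenvalue_list (ising 1 (\<gamma>(GZ 1 := 2))) [2, - 2]"
    using eigenvalue_list_ising_1[of "\<gamma>(GZ 1 := 2)"] by (simp add: \<gamma>_def)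
  have "nondegenerate_gaps (ising 1 \<gamma>)"
    by (rule nondegenerate_gapsI[OF E]) auto
  moreover have "gap_independent (ising 1 \<gamma>) (ising 1 (\<gamma>(GZ 1 := 2)))"
    unfolding gap_independent_def
    by (intro exI[of _ "[1, - 1]"] exI[of _ "[2, - 2]"] conjI E F) (auto simp: less_Suc_eq numeral_2_eq_2)
  ultimately show ?case by blast
next
  case (Suc N)
  then have N: "1 \<le> N" by simp
  let ?n = "2 ^ N :: nat"
  have n: "0 < ?n" by simp
  obtain \<gamma>1 \<gamma>2 \<beta>2 where P: "nondegenerate_gaps (ising N \<gamma>1)"
    and Q: "gap_independent (ising N \<gamma>2) (ising N (\<gamma>2(GZ 1 := \<beta>2)))"
    using Suc.IH by blast
  have "\<exists>\<gamma>. nondegenerate_gaps (ising (Suc N) \<gamma>)"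
  proof -
    \<comment> \<open>A segment joins the data of the two claims: at \<open>t = 0\<close> both
      chains are the nondegenerate one, at \<open>t = 1\<close> they are the gap independent pair.
      Each property fails for finitely many \<open>t\<close> only, so all hold together at some
      \<open>t\<close>.\<close>
    define \<gamma> where "\<gamma> = (\<lambda>t p. \<gamma>1 p + t * (\<gamma>2 p - \<gamma>1 p))"
    define b where "b = (\<lambda>t. \<gamma>1 (GZ 1) + t * (\<beta>2 - \<gamma>1 (GZ 1)))"
    have poly: "(\<lambda>t. complex_of_real (\<gamma> t p)) \<in> real_polynomials" for p
      unfolding \<gamma>_def by (rule real_polynomials_affine)
    have poly': "(\<lambda>t. complex_of_real (((\<gamma> t)(GZ 1 := b t)) p)) \<in> real_polynomials" for p
      by (intro real_polynomials_field poly) (unfold b_def, rule real_polynomials_affine)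
    note e = real_polynomials.ising_entry[OF poly] and e' = real_polynomials.ising_entry[OF poly']
    have at: "\<gamma> 0 = \<gamma>1" "(\<gamma> 0)(GZ 1 := b 0) = \<gamma>1" "\<gamma> 1 = \<gamma>2" "b 1 = \<beta>2"
      by (auto simp: \<gamma>_def b_def)
    have "finite {t. \<not> nondegenerate_gaps (ising N (\<gamma> t))}"
      by (rule finite_not_nondegenerate_gaps[OF ising_carrier e, where s = 0]) (use P at in simp_all)
    moreover have "finite {t. \<not> nondegenerate_gaps (ising N ((\<gamma> t)(GZ 1 := b t)))}"
      by (rule finite_not_nondegenerate_gaps[OF ising_carrier e', where s = 0]) (use P in \<open>simp_all only: at(2)\<close>)
    moreover have "finite {t. \<not> gap_independent (ising N (\<gamma> t)) (ising N ((\<gamma> t)(GZ 1 := b t)))}"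
      by (rule finite_not_gap_independent[OF ising_carrier e ising_carrier e', where s = 1]) (use Q in \<open>simp_all only: at\<close>)
    ultimately have "finite ({t. \<not> nondegenerate_gaps (ising N (\<gamma> t))}
      \<union> {t. \<not> nondegenerate_gaps (ising N ((\<gamma> t)(GZ 1 := b t)))}
      \<union> {t. \<not> gap_independent (ising N (\<gamma> t)) (ising N ((\<gamma> t)(GZ 1 := b t)))})" (is "finite ?S")
      by (intro finite_UnI)
    then have "\<exists>t. t \<notin> ?S" by (rule ex_new_if_finite[OF infinite_UNIV_char_0])
    then obtain t where "t \<notin> ?S" ..
    then have t: "nondegenerate_gaps (ising N (\<gamma> t))"
      "nondegenerate_gaps (ising N ((\<gamma> t)(GZ 1 := b t)))"
      "gap_independent (ising N (\<gamma> t)) (ising N ((\<gamma> t)(GZ 1 := b t)))"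
      by simp_all
    \<comment> \<open>Solved so that \<open>\<delta> (GZ 1) + c\<close> and
      \<open>\<delta> (GZ 1) - c\<close> are the first fields of the two chains.\<close>
    define c where "c = (\<gamma> t (GZ 1) - b t) / 2"
    define \<delta> where "\<delta> = (\<gamma> t)(GZ 1 := (\<gamma> t (GZ 1) + b t) / 2)"
    have v: "\<delta> (GZ 1) + c = \<gamma> t (GZ 1)" "\<delta> (GZ 1) + - c = b t"
      by (simp_all add: \<delta>_def c_def field_simps)
    have "\<delta>(GZ 1 := \<delta> (GZ 1) + c) = \<gamma> t" "\<delta>(GZ 1 := \<delta> (GZ 1) + - c) = (\<gamma> t)(GZ 1 := b t)"
      unfolding v by (simp_all add: \<delta>_def)
    \<comment> \<open>With transverse field 0 on the new spin the longer chain is block diagonal;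
      its longitudinal field is left open to serve as the large shift.\<close>
    note ext = ising_extend_params[OF N, of 0 _ c \<delta>, unfolded this]
    obtain d where "nondegenerate_gaps (four_block_mat (ising N (\<gamma> t) + of_real d \<cdot>\<^sub>m 1\<^sub>m ?n) (0\<^sub>m ?n ?n)
        (0\<^sub>m ?n ?n) (ising N ((\<gamma> t)(GZ 1 := b t)) + of_real (- d) \<cdot>\<^sub>m 1\<^sub>m ?n))"
      by (rule nondegenerate_gaps_block[OF ising_carrier ising_carrier n t])
    moreover have "complex_of_real 0 \<cdot>\<^sub>m 1\<^sub>m ?n = 0\<^sub>m ?n ?n" by auto
    ultimately have "nondegenerate_gaps (ising (Suc N) (extend_params 0 d c \<delta>))"
      by (simp only: ext)
    then show ?thesis by blast
  qed
  moreover have "\<exists>\<gamma> \<beta>. gap_independent (ising (Suc N) \<gamma>) (ising (Suc N) (\<gamma>(GZ 1 := \<beta>)))"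
  proof -
    define b0 where "b0 = \<gamma>2 (GZ 1)"
    define f where "f = (\<lambda>t. ising N (\<gamma>2(GZ 1 := t)))"
    have poly: "(\<lambda>t. complex_of_real ((\<gamma>2(GZ 1 := t)) p)) \<in> real_polynomials" for p
      by (rule real_polynomials_field) (auto intro: real_polynomials.const real_polynomials_of_real)
    \<comment> \<open>\<open>B\<close> collects the exceptional first fields. It is finite because
      the induction hypothesis provides a field outside it.\<close>
    define B where "B = {t. \<not> gap_independent (ising N \<gamma>2) (f t)}"
    have "finite B"
      unfolding B_def f_def
      by (rule finite_not_gap_independent[OF ising_carrier real_polynomials.const ising_carrier
            real_polynomials.ising_entry[OF poly] Q])
    then have "finite ((\<lambda>t. t - b0) ` B \<union> (\<lambda>t. b0 - t) ` B)" by simp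
    \<comment> \<open>Neither \<open>b0 + c\<close> nor \<open>b0 - c\<close> may be
      exceptional.\<close>
    then obtain c where c: "c \<notin> (\<lambda>t. t - b0) ` B \<union> (\<lambda>t. b0 - t) ` B"
      using ex_new_if_finite[OF infinite_UNIV_char_0] by blast
    have "b0 + c \<notin> B" "b0 + - c \<notin> B"
      using c by (auto simp: image_iff algebra_simps)
    then have ind: "gap_independent (ising N \<gamma>2) (f (b0 + c))" "gap_independent (ising N \<gamma>2) (f (b0 + - c))"
      by (simp_all add: B_def)
    have "f (b0 + c) + f (b0 + - c) = ising N \<gamma>2 + ising N \<gamma>2"
    proof (rule eq_matI)
      fix i j assume "i < dim_row (ising N \<gamma>2 + ising N \<gamma>2)" "j < dim_col (ising N \<gamma>2 + ising N \<gamma>2)"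
      then have ij: "i < ?n" "j < ?n" by (simp_all add: carrier_matD[OF ising_carrier])
      have "f (b0 + d) $$ (i, j) = ising N \<gamma>2 $$ (i, j) + of_real d * on_site N 1 pauli_z $$ (i, j)" for d
        unfolding f_def b0_def by (rule ising_field_index[OF N ij])
      from this[of c] this[of "- c"]
      show "(f (b0 + c) + f (b0 + - c)) $$ (i, j) = (ising N \<gamma>2 + ising N \<gamma>2) $$ (i, j)"
        using ij by (simp add: f_def carrier_matD[OF ising_carrier])
    qed (simp_all add: f_def carrier_matD[OF ising_carrier])
    then obtain \<alpha> \<beta> \<beta>' where
      "gap_independent (four_block_mat (f (b0 + c) + complex_of_real \<beta> \<cdot>\<^sub>m 1\<^sub>m ?n) (complex_of_real \<alpha> \<cdot>\<^sub>m 1\<^sub>m ?n)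
         (complex_of_real \<alpha> \<cdot>\<^sub>m 1\<^sub>m ?n) (f (b0 + - c) + complex_of_real (- \<beta>) \<cdot>\<^sub>m 1\<^sub>m ?n))
       (four_block_mat (f (b0 + c) + complex_of_real \<beta>' \<cdot>\<^sub>m 1\<^sub>m ?n) (complex_of_real \<alpha> \<cdot>\<^sub>m 1\<^sub>m ?n)
         (complex_of_real \<alpha> \<cdot>\<^sub>m 1\<^sub>m ?n) (f (b0 + - c) + complex_of_real (- \<beta>') \<cdot>\<^sub>m 1\<^sub>m ?n))"
      using gap_independent_block[OF ising_carrier _ _ n _ ind] by (auto simp: f_def)
    \<comment> \<open>The two block matrices differ only in the longitudinal field of the new spin,
      which is now the first site.\<close>
    moreover have "(extend_params \<alpha> \<beta> c \<gamma>2)(GZ 1 := \<beta>') = extend_params \<alpha> \<beta>' c \<gamma>2"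
      by (auto simp: extend_params_def fun_eq_iff split: param.split)
    ultimately have "gap_independent (ising (Suc N) (extend_params \<alpha> \<beta> c \<gamma>2))
        (ising (Suc N) ((extend_params \<alpha> \<beta> c \<gamma>2)(GZ 1 := \<beta>')))"
      by (simp only: ising_extend_params[OF N] f_def b0_def)
    then show ?thesis by blast
  qed
  ultimately show ?case by blast
qed

section \<open>The Hamiltonian with hopping\<close>

text \<open>Splits off the parameter-free hopping terms; the strengths go into the parameters of the
  Ising chain.\<close>

lemma H_XXZ_index:
  assumes "r < 2 ^ N" "c < 2 ^ N"
  shows "H_XXZ N hx hz hzz \<gamma> $$ (r, c) =
    (\<Sum>j\<in>{1..<N}. (on_site N j pauli_x * on_site N (j + 1) pauli_x) $$ (r, c)
       + (on_site N j pauli_y * on_site N (j + 1) pauli_y) $$ (r, c)) +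
    ising N (\<lambda>p. (case p of GX _ \<Rightarrow> hx | GZ _ \<Rightarrow> hz | GZZ _ \<Rightarrow> hzz) * \<gamma> p) $$ (r, c)"
proof -
  have 1: "(of_real a \<cdot>\<^sub>m on_site N j pauli_x + of_real b \<cdot>\<^sub>m on_site N j pauli_z) $$ (r, c)
     = of_real a * on_site N j pauli_x $$ (r, c) + of_real b * on_site N j pauli_z $$ (r, c)"
    if "j \<in> {1..N}" for j and a b :: real
  proof -
    have j: "1 \<le> j" "j \<le> N" using that by auto
    show ?thesis using assms on_site_carrier[OF j pauli_carrier(1)] on_site_carrier[OF j pauli_carrier(3)]
      by simp
  qed
  have 2: "(on_site N j pauli_x * on_site N (j + 1) pauli_x + on_site N j pauli_y * on_site N (j + 1) pauli_y
       + of_real a \<cdot>\<^sub>m (on_site N j pauli_z * on_site N (j + 1) pauli_z)) $$ (r, c)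
     = (on_site N j pauli_x * on_site N (j + 1) pauli_x) $$ (r, c)
       + (on_site N j pauli_y * on_site N (j + 1) pauli_y) $$ (r, c)
       + of_real a * (on_site N j pauli_z * on_site N (j + 1) pauli_z) $$ (r, c)"
    if "j \<in> {1..<N}" for j and a :: real
  proof -
    have j: "1 \<le> j" "j \<le> N" "1 \<le> j + 1" "j + 1 \<le> N" using that by auto
    have "dim_row (on_site N j S) = 2 ^ N" "dim_col (on_site N (j + 1) S) = 2 ^ N"
      if "S \<in> carrier_mat 2 2" for S
      using on_site_carrier[OF j(1,2) that] on_site_carrier[OF j(3,4) that] by auto
    from this[OF pauli_carrier(1)] this[OF pauli_carrier(2)] this[OF pauli_carrier(3)]
    show ?thesis using assms by (simp del: index_mult_mat(1) assoc_add_mat)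
  qed
  show ?thesis
    unfolding H_XXZ_def ising_index[OF assms] using assms
    by (simp only: mat_sum_def index_add_mat dim_row_mat dim_col_mat index_mat split 1 2 cong: sum.cong)
      (simp add: sum.distrib)
qed

lemma H_XXZ_carrier: "H_XXZ N hx hz hzz \<gamma> \<in> carrier_mat (2 ^ N) (2 ^ N)"
  by (rule carrier_matI) (simp_all add: H_XXZ_def mat_sum_def)

text \<open>The hopping terms are a perturbation of size \<open>1/t\<close> of the Ising chain when the other
  parameters are scaled by \<open>t\<close>.\<close>

lemma exists_nondegenerate_H_XXZ:
  assumes N: "1 \<le> N" and h: "hx > 0" "hz > 0" "hzz > 0"
  shows "\<exists>\<gamma>. nondegenerate_gaps (H_XXZ N hx hz hzz \<gamma>)"
proof -
  let ?n = "2 ^ N :: nat"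
  obtain \<gamma> where \<gamma>: "nondegenerate_gaps (ising N \<gamma>)"
    using ising_generic_gaps[OF N] by blast
  define X where "X = (\<lambda>r c. \<Sum>j\<in>{1..<N}. (on_site N j pauli_x * on_site N (j + 1) pauli_x) $$ (r, c)
       + (on_site N j pauli_y * on_site N (j + 1) pauli_y) $$ (r, c))"
  \<comment> \<open>\<open>A 0\<close> is the good Ising chain, so \<open>A t\<close> is good for
    all but finitely many \<open>t\<close>, in particular for some nonzero one.\<close>
  define A where "A = (\<lambda>t. mat ?n ?n (\<lambda>(r, c). of_real t * X r c + ising N \<gamma> $$ (r, c)))"
  have A: "A t \<in> carrier_mat ?n ?n" for t by (simp add: A_def)
  have A0: "A 0 = ising N \<gamma>"
    by (rule eq_matI) (simp_all add: A_def carrier_matD[OF ising_carrier])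
  have "finite {t. \<not> nondegenerate_gaps (A t)}"
  proof (rule finite_not_nondegenerate_gaps[OF A, where s = 0])
    fix i j assume "i < ?n" "j < ?n"
    then show "(\<lambda>t. A t $$ (i, j)) \<in> real_polynomials"
      by (auto simp: A_def intro!: real_polynomials.add real_polynomials.mult real_polynomials.const
          real_polynomials_of_real)
  qed (simp add: A0 \<gamma>)
  then have "finite (insert 0 {t. \<not> nondegenerate_gaps (A t)})" by simp
  then obtain t where "t \<notin> insert 0 {t. \<not> nondegenerate_gaps (A t)}"
    using ex_new_if_finite[OF infinite_UNIV_char_0] by blast
  then have t: "t \<noteq> 0" "nondegenerate_gaps (A t)" by auto
  define w where "w = (\<lambda>p. case p of GX _ \<Rightarrow> hx | GZ _ \<Rightarrow> hz | GZZ _ \<Rightarrow> hzz)"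
  have w: "w p > 0" for p using h by (simp add: w_def split: param.split)
  \<comment> \<open>Dividing \<open>A t\<close> by \<open>t\<close> restores coefficient 1 for the
    hopping terms, and dividing by \<open>w p\<close> cancels the strengths. The resulting
    parameters are not confined to [- 1, 1].\<close>
  have "H_XXZ N hx hz hzz (\<lambda>p. \<gamma> p / (t * w p)) = of_real (1 / t) \<cdot>\<^sub>m A t"
  proof (rule eq_matI)
    fix r c assume "r < dim_row (of_real (1 / t) \<cdot>\<^sub>m A t)" "c < dim_col (of_real (1 / t) \<cdot>\<^sub>m A t)"
    then have rc: "r < ?n" "c < ?n" by (simp_all add: A_def)
    have "w p * (\<gamma> p / (t * w p)) = 1 / t * \<gamma> p" for p using w[of p] by simp
    then have "ising N (\<lambda>p. w p * (\<gamma> p / (t * w p))) $$ (r, c) = of_real (1 / t) * ising N \<gamma> $$ (r, c)"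
      unfolding ising_index[OF rc] by (simp add: sum_distrib_left distrib_left mult.assoc)
    moreover have "H_XXZ N hx hz hzz \<gamma>' $$ (r, c) = X r c + ising N (\<lambda>p. w p * \<gamma>' p) $$ (r, c)" for \<gamma>'
      by (simp only: H_XXZ_index[OF rc] w_def X_def)
    ultimately show "H_XXZ N hx hz hzz (\<lambda>p. \<gamma> p / (t * w p)) $$ (r, c) = (of_real (1 / t) \<cdot>\<^sub>m A t) $$ (r, c)"
      using rc t(1) by (simp add: A_def distrib_left)
  qed (simp_all add: A_def carrier_matD[OF H_XXZ_carrier])
  then have "nondegenerate_gaps (H_XXZ N hx hz hzz (\<lambda>p. \<gamma> p / (t * w p)))"
    using nondegenerate_gaps_smult[OF A _ t(2), of "of_real (1 / t)"] t(1) by simp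
  then show ?thesis by blast
qed

theorem corollary2:
  fixes N :: nat and hx hz hzz :: real
  assumes "N \<ge> 1" and "hx > 0" and "hz > 0" and "hzz > 0"
  shows "{\<gamma> \<in> params N \<rightarrow>\<^sub>E {- 1..1}. \<not> nondegenerate_gaps (H_XXZ N hx hz hzz \<gamma>)}
           \<in> null_sets (lebesgue_on_coords (params N))"
proof -
  have entry: "(\<lambda>\<gamma>. H_XXZ N hx hz hzz \<gamma> $$ (r, c)) \<in> polynomial_functions (params N)"
    if "r < 2 ^ N" "c < 2 ^ N" for r c
    unfolding H_XXZ_index[OF that] of_real_mult
    by (intro polynomial_functions_algebra.add polynomial_functions_algebra.const
        polynomial_functions_algebra.ising_entry that)
      (simp, intro polynomial_functions_algebra.mult polynomial_functions_algebra.const polynomial_functions.coord)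
  obtain D where D: "D \<in> polynomial_functions (params N)"
    "\<And>\<gamma>. D \<gamma> \<noteq> 0 \<longleftrightarrow> nondegenerate_gaps (H_XXZ N hx hz hzz \<gamma>)"
    using polynomial_functions_algebra.nondegenerate_gaps_polynomial[OF H_XXZ_carrier entry] by blast
  \<comment> \<open>Any point with nonzero value will do, even outside the cube, because it shows
    that \<open>D\<close> does not vanish identically.\<close>
  obtain \<gamma>\<^sub>0 where "D \<gamma>\<^sub>0 \<noteq> 0"
    using exists_nondegenerate_H_XXZ[OF assms] D(2) by blast
  let ?M = "Pi\<^sub>M (params N) (\<lambda>_. lborel :: real measure)"
  have "AE \<gamma> in ?M. D \<gamma> \<noteq> 0"
    using \<open>D \<gamma>\<^sub>0 \<noteq> 0\<close>
    by (intro AE_polynomial_function_nonzero[OF _ D(1)]) (simp_all add: params_def)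
  moreover have "{\<gamma> \<in> space ?M. \<not> D \<gamma> \<noteq> 0} \<in> sets ?M"
    using polynomial_functions_measurable[OF D(1)] by measurable
  ultimately have null: "{\<gamma> \<in> space ?M. \<not> D \<gamma> \<noteq> 0} \<in> null_sets (completion ?M)"
    by (simp only: AE_iff_null null_sets_completionI)
  \<comment> \<open>In the completed measure every subset of a null set is a null set, which settles
    the measurability of the bad set too.\<close>
  have "{\<gamma> \<in> params N \<rightarrow>\<^sub>E {- 1..1}. \<not> nondegenerate_gaps (H_XXZ N hx hz hzz \<gamma>)}
      \<subseteq> {\<gamma> \<in> space ?M. \<not> D \<gamma> \<noteq> 0}"
    unfolding D(2) by (auto simp: space_PiM PiE_def)
  then show ?thesis
    unfolding lebesgue_on_coords_def by (rule null_sets_completion_subset[OF _ null])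
qed

end
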